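(* Let $n\in\mathbb{N}$ be a fixed number. For each $k\in\mathbb{N}$, the homogeneous polynomials (i) $g_{2n+2}(x,y):=(x^2-y^2)(x^{2n}+y^{2n})$ of even degree $2n+2$, with $n\ge 2$, (ii) $f_{2k+1}(x,y):=x\,(x^{2n}+y^{2n})\prod_{i=1}^k(x^2-i^2y^2)$ of odd degree $2n+2k+1$, and (iii) $f_{2k+2}(x,y):=x\,(x^{2n}+y^{2n})\,\big(x-(k+1)y\big)\prod_{i=1}^k(x^2-i^2y^2)$ of even degree $2n+2k+2$, are hyperbolic. Moreover, $\mathrm{Ind}(\gamma_{g_{2n+2}})=0$, and $\mathrm{Ind}(\gamma_{f_{2k+j}})=2-2k-j$ for $j\in\{1,2\}$.
   Context: $\mathbb{N}=\{1,2,3,\dots\}$. A homogeneous polynomial $f\in\mathbb{R}[x,y]$ of degree at least $2$ is hyperbolic if its Hessian polynomial $f_{xx}f_{yy}-f_{xy}^2$ is negative at every point of $\mathbb{R}^2\setminus\{(0,0)\}$. For a hyperbolic homogeneous polynomial $f$, the curve $\gamma_f$ is the closed curve in the space of real quadratic forms $a\psi^2+2b\psi\eta+c\eta^2$, identified with triples $(a,b,c)\in\mathbb{R}^3$, given by $\gamma_f(\varphi)=(f_{xx},f_{xy},f_{yy})(\cos\varphi,\sin\varphi)$, $\varphi\in[0,2\pi]$. Its index is the integer $$\mathrm{Ind}(\gamma_f)=\frac{1}{2\pi}\,\Delta\arg\big(a-c+2b\,i\big)(\varphi)\Big|_{0}^{2\pi},$$ i.e. the winding number around $0\in\mathbb{C}$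 of $\varphi\mapsto (f_{xx}-f_{yy}+2if_{xy})(\cos\varphi,\sin\varphi)$.
   Formalization: In (ii) hyperbolicity is claimed only for (n,k) ≠ (1,1): for n = k = 1 the polynomial x^5 − xy^4 has Hessian −240x^4y^2 − 16y^6, which vanishes at (1,0); its index formula is still proved. *)

theory Defs
  imports "HOL-Complex_Analysis.Complex_Analysis"
begin

text \<open>
  The ring \<open>\<real>[x,y]\<close> is represented as \<open>\<real>[y][x]\<close>, that is, by the type \<open>real poly poly\<close>:
  \<open>coeff (coeff f i) j\<close> is the coefficient of \<open>x ^ i * y ^ j\<close> in \<open>f\<close>.
\<close>

type_synonym bipoly = "real poly poly"

definition X :: bipoly where "X = [:0, 1:]"

definition Y :: bipoly where "Y = [:[:0, 1:]:]"

definition eval2 :: "bipoly \<Rightarrow> real \<Rightarrow> real \<Rightarrow> real" where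
  "eval2 f x y = poly (poly f [:x:]) y"

definition pderiv_x :: "bipoly \<Rightarrow> bipoly" where
  "pderiv_x f = pderiv f"

definition pderiv_y :: "bipoly \<Rightarrow> bipoly" where
  "pderiv_y f = map_poly pderiv f"

definition hessian :: "bipoly \<Rightarrow> bipoly" where
  "hessian f = pderiv_x (pderiv_x f) * pderiv_y (pderiv_y f) - (pderiv_y (pderiv_x f))\<^sup>2"

text \<open>The zero polynomial is homogeneous of every degree.\<close>

definition homogeneous :: "nat \<Rightarrow> bipoly \<Rightarrow> bool" where
  "homogeneous d f \<longleftrightarrow> (\<forall>i j. coeff (coeff f i) j \<noteq> 0 \<longrightarrow> i + j = d)"

definition hyperbolic :: "bipoly \<Rightarrow> bool" where
  "hyperbolic f \<longleftrightarrow>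
     (\<exists>d\<ge>2. homogeneous d f) \<and>
     (\<forall>x y. (x, y) \<noteq> (0, 0) \<longrightarrow> eval2 (hessian f) x y < 0)"

text \<open>
  The triple \<open>(a, b, c)\<close> stands for the quadratic form
  \<open>a * \<psi>\<^sup>2 + 2 * b * \<psi> * \<eta> + c * \<eta>\<^sup>2\<close>.
\<close>

definition gamma :: "bipoly \<Rightarrow> real \<Rightarrow> real \<times> real \<times> real" where
  "gamma f \<phi> =
     (eval2 (pderiv_x (pderiv_x f)) (cos \<phi>) (sin \<phi>),
      eval2 (pderiv_y (pderiv_x f)) (cos \<phi>) (sin \<phi>),
      eval2 (pderiv_y (pderiv_y f)) (cos \<phi>) (sin \<phi>))"

text \<open>
  Library paths are parametrised by \<open>[0, 1]\<close>, whence the substitution \<open>\<phi> = 2 * pi * t\<close>. The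
  value of \<^const>\<open>winding_number\<close> is a complex number; it is an integer whenever the closed
  curve avoids \<open>0\<close>. For \<open>gamma f\<close> with \<open>f\<close> hyperbolic it does: \<open>a = c\<close> and \<open>b = 0\<close> would give
  \<open>a * c - b\<^sup>2 = a\<^sup>2 \<ge> 0\<close>.
\<close>

definition Ind :: "(real \<Rightarrow> real \<times> real \<times> real) \<Rightarrow> complex" where
  "Ind \<gamma> = winding_number (\<lambda>t. case \<gamma> (2 * pi * t) of (a, b, c) \<Rightarrow> Complex (a - c) (2 * b)) 0"

definition g_poly :: "nat \<Rightarrow> bipoly" where
  "g_poly n = (X\<^sup>2 - Y\<^sup>2) * (X ^ (2 * n) + Y ^ (2 * n))"

text \<open>
  \<open>f_odd n k\<close> and \<open>f_even n k\<close> are the polynomials \<open>f\<^bsub>2k+1\<^esub>\<close> and \<open>f\<^bsub>2k+2\<^esub>\<close>, with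
  the parameter \<open>n\<close> made explicit.
\<close>

definition f_odd :: "nat \<Rightarrow> nat \<Rightarrow> bipoly" where
  "f_odd n k = X * (X ^ (2 * n) + Y ^ (2 * n)) * (\<Prod>i=1..k. X\<^sup>2 - of_nat i ^ 2 * Y\<^sup>2)"

definition f_even :: "nat \<Rightarrow> nat \<Rightarrow> bipoly" where
  "f_even n k = X * (X ^ (2 * n) + Y ^ (2 * n)) * (X - of_nat (k + 1) * Y) *
     (\<Prod>i=1..k. X\<^sup>2 - of_nat i ^ 2 * Y\<^sup>2)"

text \<open>
  The polynomial \<open>f_odd 1 1\<close> is \<open>x ^ 5 - x * y ^ 4\<close>, with Hessian
  \<open>- 240 * x ^ 4 * y\<^sup>2 - 16 * y ^ 6\<close>, which vanishes on the line \<open>y = 0\<close>.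
  The pair \<open>n = k = 1\<close> therefore has to be excluded from the hyperbolicity claim for \<open>f_odd n k\<close>.
\<close>

lemma not_hyperbolic_f_odd_1_1: "\<not> hyperbolic (f_odd 1 1)"
proof -
  have f: "f_odd 1 1 = [:0, - [:0, 0, 0, 0, 1:], 0, 0, 0, 1:]"
    by (simp add: f_odd_def X_def Y_def power2_eq_square algebra_simps one_pCons)
  have "eval2 (hessian (f_odd 1 1)) 1 0 = 0"
    unfolding f
    by (simp add: eval2_def hessian_def pderiv_x_def pderiv_y_def pderiv_pCons map_poly_pCons
        power2_eq_square one_pCons numeral_poly)
  then show ?thesis
    unfolding hyperbolic_def by (metis less_irrefl prod.inject zero_neq_one)
qed

end

theory Submission
  imports Defs
begin

text \<open>
  All three families are of the form \<open>f = (x\<^sup>2\<^sup>n + y\<^sup>2\<^sup>n) \<Prod>\<^sub>a (x - a y)\<close>, where \<open>a\<close> ranges over a set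
  \<open>A\<close> of \<open>m\<close> distinct reals that contains \<open>1\<close> and \<open>-1\<close>. Let \<open>N = 2n\<close> and \<open>d = N + m\<close>.

  Hyperbolicity. By Euler's identity \<open>y\<^sup>2 Hess f = (d-1) (d f f\<^sub>x\<^sub>x - (d-1) f\<^sub>x\<^sup>2)\<close>. In terms of
  \<open>s\<^sub>a = x / (x - a y)\<close> and \<open>w = x\<^sup>N / (x\<^sup>N + y\<^sup>N)\<close> the Hessian is negative if and only if
  \<open>m \<Sum> s\<^sub>a\<^sup>2 - (\<Sum> s\<^sub>a)\<^sup>2 + N \<Sum> (s\<^sub>a - w)\<^sup>2 > N (N-1) (N+m) w (1-w)\<close>.
  The left-hand side is at least \<open>(N+m) (s\<^sub>1 - s\<^sub>-\<^sub>1)\<^sup>2 / 2\<close>, so that the lines \<open>x = y\<close> and \<open>x = -y\<close>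
  suffice, by the inequality \<open>cosh\<^sup>2 (n\<tau>) > n (2n-1) sinh\<^sup>2 \<tau>\<close>.

  Index. If \<open>Hess f \<le> 0\<close>, the curve \<open>a - c + 2bi\<close> is \<open>e\<^bsup>2i\<phi>\<^esup>\<close> times a loop that never points
  opposite to \<open>F + i F'\<close>, where \<open>F \<phi> = f (cos \<phi>, sin \<phi>)\<close>. The winding number of \<open>F + i F'\<close> is additive
  in products with simple zeros; a line contributes \<open>-1\<close> and a positive factor \<open>0\<close>. Hence the index
  is \<open>2 - m\<close>.
\<close>

subsection \<open>Bivariate polynomials\<close>

lemma eval2_add [simp]: "eval2 (f + g) x y = eval2 f x y + eval2 g x y"
  and eval2_diff [simp]: "eval2 (f - g) x y = eval2 f x y - eval2 g x y"
  and eval2_minus [simp]: "eval2 (- f) x y = - eval2 f x y"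
  and eval2_smult [simp]: "eval2 (smult p f) x y = poly p y * eval2 f x y"
  and eval2_mult [simp]: "eval2 (f * g) x y = eval2 f x y * eval2 g x y"
  and eval2_power [simp]: "eval2 (f ^ k) x y = eval2 f x y ^ k"
  and eval2_0 [simp]: "eval2 0 x y = 0"
  and eval2_1 [simp]: "eval2 1 x y = 1"
  and eval2_of_nat [simp]: "eval2 (of_nat k) x y = of_nat k"
  and eval2_numeral [simp]: "eval2 (numeral w) x y = numeral w"
  and eval2_prod: "eval2 (prod F A) x y = (\<Prod>a\<in>A. eval2 (F a) x y)"
  and eval2_X [simp]: "eval2 X x y = x"
  and eval2_Y [simp]: "eval2 Y x y = y"
  and eval2_const [simp]: "eval2 [:p:] x y = poly p y"
  and eval2_pCons: "eval2 (pCons p f) x y = poly p y + x * eval2 f x y"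
  by (simp_all add: eval2_def X_def Y_def poly_prod)

lemma pderiv_x_add [simp]: "pderiv_x (f + g) = pderiv_x f + pderiv_x g"
  and pderiv_x_diff [simp]: "pderiv_x (f - g) = pderiv_x f - pderiv_x g"
  and pderiv_x_mult: "pderiv_x (f * g) = pderiv_x f * g + f * pderiv_x g"
  and pderiv_x_X [simp]: "pderiv_x X = 1"
  and pderiv_x_const [simp]: "pderiv_x [:p:] = 0"
  by (simp_all add: pderiv_x_def X_def pderiv_add pderiv_diff pderiv_mult pderiv_pCons
      algebra_simps)

lemma pderiv_y_add [simp]: "pderiv_y (f + g) = pderiv_y f + pderiv_y g"
  and pderiv_y_diff [simp]: "pderiv_y (f - g) = pderiv_y f - pderiv_y g"
  by (rule poly_eqI; simp add: pderiv_y_def coeff_map_poly pderiv_add pderiv_diff)+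

lemma pderiv_y_pCons: "pderiv_y (pCons p f) = pCons (pderiv p) (pderiv_y f)"
  by (simp add: pderiv_y_def map_poly_pCons)

lemma pderiv_y_X [simp]: "pderiv_y X = 0"
  by (simp add: X_def pderiv_y_def map_poly_pCons)

lemma pderiv_y_const [simp]: "pderiv_y [:p:] = [:pderiv p:]"
  by (simp add: pderiv_y_def map_poly_pCons)

lemma pderiv_y_smult: "pderiv_y (smult p f) = smult (pderiv p) f + smult p (pderiv_y f)"
  by (rule poly_eqI) (simp add: pderiv_y_def coeff_map_poly pderiv_mult algebra_simps)

lemma pderiv_y_mult: "pderiv_y (f * g) = pderiv_y f * g + f * pderiv_y g"
proof (induction f)
  case 0
  then show ?case by (simp add: pderiv_y_def)
next
  case (pCons p f)
  then show ?case
    by (simp add: pderiv_y_pCons pderiv_y_smult algebra_simps)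
qed

lemma pderiv_x_y_commute: "pderiv_x (pderiv_y f) = pderiv_y (pderiv_x f)"
proof -
  have "pderiv (of_nat k * p) = of_nat k * pderiv p" for k and p :: "real poly"
    by (simp add: pderiv_mult)
  then show ?thesis
    by (intro poly_eqI) (simp add: pderiv_x_def pderiv_y_def coeff_map_poly coeff_pderiv
        del: of_nat_Suc)
qed

lemma pderiv_y_of_nat [simp]: "pderiv_y (of_nat k) = 0"
  by (simp add: of_nat_poly)

lemma pderiv_x_of_nat [simp]: "pderiv_x (of_nat k) = 0"
  by (simp add: of_nat_poly)

lemma pderiv_y_1 [simp]: "pderiv_y 1 = 0" and pderiv_x_1 [simp]: "pderiv_x 1 = 0"
  using pderiv_y_of_nat[of 1] pderiv_x_of_nat[of 1] by simp_all

lemma pderiv_y_Y [simp]: "pderiv_y Y = 1" and pderiv_x_Y [simp]: "pderiv_x Y = 0"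
  by (simp_all add: Y_def pderiv_pCons one_pCons)

lemma pderiv_x_power: "pderiv_x (f ^ k) = of_nat k * f ^ (k - 1) * pderiv_x f"
  and pderiv_y_power: "pderiv_y (f ^ k) = of_nat k * f ^ (k - 1) * pderiv_y f"
proof (induction k)
  case (Suc k)
  {
    case 1
    then show ?case
      using Suc by (cases k) (simp_all add: pderiv_x_mult algebra_simps)
  next
    case 2
    then show ?case
      using Suc by (cases k) (simp_all add: pderiv_y_mult algebra_simps)
  }
qed simp_all

section \<open>Homogeneity, Euler's identity and the Hessian\<close>

lemma homogeneous_mult:
  assumes "homogeneous d f" "homogeneous e g"
  shows "homogeneous (d + e) (f * g)"
  unfolding homogeneous_def
proof (intro allI impI)
  fix i j assume "coeff (coeff (f * g) i) j \<noteq> 0"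
  then have "(\<Sum>k\<le>i. \<Sum>l\<le>j. coeff (coeff f k) l * coeff (coeff g (i - k)) (j - l)) \<noteq> 0"
    by (simp add: coeff_mult coeff_sum)
  then obtain k l where "k \<le> i" "l \<le> j" "coeff (coeff f k) l * coeff (coeff g (i - k)) (j - l) \<noteq> 0"
    by (meson atMost_iff sum.not_neutral_contains_not_neutral)
  then have "k + l = d" "(i - k) + (j - l) = e"
    using assms by (auto simp: homogeneous_def)
  with \<open>k \<le> i\<close> \<open>l \<le> j\<close> show "i + j = d + e" by simp
qed

lemma homogeneous_add: "homogeneous d f \<Longrightarrow> homogeneous d g \<Longrightarrow> homogeneous d (f + g)"
  unfolding homogeneous_def by (metis add.right_neutral coeff_add)

lemma homogeneous_1: "homogeneous 0 1"
  by (auto simp: homogeneous_def one_pCons coeff_pCons split: nat.splits)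

lemma homogeneous_X: "homogeneous 1 X" and homogeneous_Y: "homogeneous 1 Y"
  by (auto simp: homogeneous_def X_def Y_def coeff_pCons split: nat.splits)

lemma homogeneous_power: "homogeneous d f \<Longrightarrow> homogeneous (d * k) (f ^ k)"
proof (induction k)
  case (Suc k)
  then show ?case using homogeneous_mult[of d f "d * k" "f ^ k"] by simp
qed (simp add: homogeneous_1)

lemma homogeneous_prod:
  "(\<And>a. a \<in> A \<Longrightarrow> homogeneous 1 (F a)) \<Longrightarrow> homogeneous (card A) (prod F A)"
proof (induction A rule: infinite_finite_induct)
  case (insert a A)
  then show ?case using homogeneous_mult[of 1 "F a" "card A" "prod F A"] by simp
qed (simp_all add: homogeneous_1)

text \<open>\<open>X * pderiv_x\<close> multiplies the coefficient of \<open>x ^ i * y ^ j\<close>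
  by \<open>i\<close> and \<open>Y * pderiv_y\<close> multiplies it by \<open>j\<close>; on the
  support of \<open>f\<close> these add up to \<open>d\<close>.\<close>

lemma euler:
  assumes "homogeneous d f"
  shows "X * pderiv_x f + Y * pderiv_y f = of_nat d * f"
proof (intro poly_eqI)
  fix i j
  have "coeff (coeff (X * pderiv_x f) i) j = of_nat i * coeff (coeff f i) j"
    by (cases i) (simp_all add: X_def pderiv_x_def coeff_pderiv of_nat_poly del: of_nat_Suc)
  moreover have "coeff (coeff (Y * pderiv_y f) i) j = of_nat j * coeff (coeff f i) j"
    by (cases j) (simp_all add: Y_def pderiv_y_def coeff_map_poly coeff_pderiv)
  moreover have "(of_nat i + of_nat j) * coeff (coeff f i) j = of_nat d * coeff (coeff f i) j"
    using assms by (cases "coeff (coeff f i) j = 0")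
      (auto simp: homogeneous_def simp flip: of_nat_add)
  ultimately show "coeff (coeff (X * pderiv_x f + Y * pderiv_y f) i) j
      = coeff (coeff (of_nat d * f) i) j"
    by (simp add: of_nat_poly algebra_simps)
qed

text \<open>The second-order identities come from differentiating the first one, not from
  homogeneity of the partial derivatives.\<close>

lemma euler_eval:
  assumes "homogeneous d f"
  shows "x * eval2 (pderiv_x f) x y + y * eval2 (pderiv_y f) x y = d * eval2 f x y"
    and "x * eval2 (pderiv_x (pderiv_x f)) x y + y * eval2 (pderiv_y (pderiv_x f)) x y
      = (real d - 1) * eval2 (pderiv_x f) x y"
    and "x * eval2 (pderiv_y (pderiv_x f)) x y + y * eval2 (pderiv_y (pderiv_y f)) x y
      = (real d - 1) * eval2 (pderiv_y f) x y"
proof -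
  note E = euler[OF assms]
  show "x * eval2 (pderiv_x f) x y + y * eval2 (pderiv_y f) x y = d * eval2 f x y"
    using arg_cong[OF E, of "\<lambda>p. eval2 p x y"] by simp
  show "x * eval2 (pderiv_x (pderiv_x f)) x y + y * eval2 (pderiv_y (pderiv_x f)) x y
      = (real d - 1) * eval2 (pderiv_x f) x y"
    using arg_cong[OF E, of "\<lambda>p. eval2 (pderiv_x p) x y"]
    by (simp add: pderiv_x_mult pderiv_x_y_commute algebra_simps)
  show "x * eval2 (pderiv_y (pderiv_x f)) x y + y * eval2 (pderiv_y (pderiv_y f)) x y
      = (real d - 1) * eval2 (pderiv_y f) x y"
    using arg_cong[OF E, of "\<lambda>p. eval2 (pderiv_y p) x y"]
    by (simp add: pderiv_y_mult algebra_simps)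
qed

lemma eval2_hessian:
  "eval2 (hessian f) x y = eval2 (pderiv_x (pderiv_x f)) x y * eval2 (pderiv_y (pderiv_y f)) x y
    - (eval2 (pderiv_y (pderiv_x f)) x y)\<^sup>2"
  by (simp add: hessian_def)

text \<open>Euler's identities eliminate the derivatives in \<open>y\<close>. The factor
  \<open>y\<^sup>2\<close> makes the formula empty on the x-axis, where the mirror image
  \<open>hessian_via_y\<close> takes over.\<close>

lemma hessian_via_x:
  assumes "homogeneous d f"
  shows "y\<^sup>2 * eval2 (hessian f) x y = (real d - 1) *
    (d * eval2 f x y * eval2 (pderiv_x (pderiv_x f)) x y - (real d - 1) * (eval2 (pderiv_x f) x y)\<^sup>2)"
proof -
  define a b c p q where "a = eval2 (pderiv_x (pderiv_x f)) x y"
    and "b = eval2 (pderiv_y (pderiv_x f)) x y" and "c = eval2 (pderiv_y (pderiv_y f)) x y"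
    and "p = eval2 (pderiv_x f) x y" and "q = eval2 (pderiv_y f) x y"
  note E = euler_eval[OF assms, of x y, folded a_def b_def c_def p_def q_def]
  \<comment> \<open>The value of the quadratic form at \<open>(x, y)\<close> times \<open>a\<close>,
    minus the square of the first row applied to \<open>(x, y)\<close>, leaves only the
    determinant.\<close>
  have "y\<^sup>2 * (a * c - b\<^sup>2) = (x * (x * a + y * b) + y * (x * b + y * c)) * a - (x * a + y * b)\<^sup>2"
    by (simp add: power2_eq_square algebra_simps)
  also have "\<dots> = ((real d - 1) * (x * p + y * q)) * a - ((real d - 1) * p)\<^sup>2"
    unfolding E(2,3) by (simp add: algebra_simps)
  also have "\<dots> = (real d - 1) * (d * eval2 f x y * a - (real d - 1) * p\<^sup>2)"
    unfolding E(1) by (simp add: power2_eq_square algebra_simps)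
  finally show ?thesis
    by (simp add: eval2_hessian a_def b_def c_def p_def)
qed

lemma hessian_via_y:
  assumes "homogeneous d f"
  shows "x\<^sup>2 * eval2 (hessian f) x y = (real d - 1) *
    (d * eval2 f x y * eval2 (pderiv_y (pderiv_y f)) x y - (real d - 1) * (eval2 (pderiv_y f) x y)\<^sup>2)"
proof -
  define a b c p q where "a = eval2 (pderiv_x (pderiv_x f)) x y"
    and "b = eval2 (pderiv_y (pderiv_x f)) x y" and "c = eval2 (pderiv_y (pderiv_y f)) x y"
    and "p = eval2 (pderiv_x f) x y" and "q = eval2 (pderiv_y f) x y"
  note E = euler_eval[OF assms, of x y, folded a_def b_def c_def p_def q_def]
  have "x\<^sup>2 * (a * c - b\<^sup>2) = (x * (x * a + y * b) + y * (x * b + y * c)) * c - (x * b + y * c)\<^sup>2"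
    by (simp add: power2_eq_square algebra_simps)
  also have "\<dots> = ((real d - 1) * (x * p + y * q)) * c - ((real d - 1) * q)\<^sup>2"
    unfolding E(2,3) by (simp add: algebra_simps)
  also have "\<dots> = (real d - 1) * (d * eval2 f x y * c - (real d - 1) * q\<^sup>2)"
    unfolding E(1) by (simp add: power2_eq_square algebra_simps)
  finally show ?thesis
    by (simp add: eval2_hessian a_def b_def c_def q_def)
qed

subsection \<open>Winding numbers of products\<close>

lemma winding_number_exp:
  assumes "path q" "\<And>t. t \<in> {0..1} \<Longrightarrow> p t = exp (q t)"
  shows "winding_number p 0 = (q 1 - q 0) / (2 * of_real pi * \<i>)"
proof -
  have "winding_number p 0 = winding_number (exp \<circ> q) 0"
    by (rule winding_number_cong) (use assms in auto)
  then show ?thesis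
    using winding_number_compose_exp[OF assms(1)] by (simp add: pathfinish_def pathstart_def)
qed

text \<open>Continuous logarithms of the factors add up to one of the product.\<close>

lemma winding_number_mult:
  assumes "path p" "path q" "0 \<notin> path_image p" "0 \<notin> path_image q"
  shows "winding_number (\<lambda>t. p t * q t) 0 = winding_number p 0 + winding_number q 0"
proof -
  obtain u where u: "path u" "pathfinish u - pathstart u = 2 * of_real pi * \<i> * winding_number p 0"
    "\<And>t. t \<in> {0..1} \<Longrightarrow> p t = 0 + exp (u t)"
    using winding_number_as_continuous_log[OF assms(1,3)] by metis
  obtain v where v: "path v" "pathfinish v - pathstart v = 2 * of_real pi * \<i> * winding_number q 0"
    "\<And>t. t \<in> {0..1} \<Longrightarrow> q t = 0 + exp (v t)"
    using winding_number_as_continuous_log[OF assms(2,4)] by metis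
  have "winding_number (\<lambda>t. p t * q t) 0
      = ((u 1 + v 1) - (u 0 + v 0)) / (2 * of_real pi * \<i>)"
    using u v by (intro winding_number_exp)
      (auto simp: exp_add path_def intro!: continuous_intros)
  also have "(u 1 + v 1) - (u 0 + v 0)
      = 2 * of_real pi * \<i> * (winding_number p 0 + winding_number q 0)"
    using u(2) v(2) by (simp add: pathfinish_def pathstart_def algebra_simps)
  finally show ?thesis by simp
qed

text \<open>Positivity says that \<open>g t\<close> and \<open>h t\<close> enclose an acute angle,
  so the segment between them misses 0 and the straight-line homotopy is admissible.\<close>

lemma winding_number_eq_if_Re_pos:
  assumes "path g" "path h" "g 1 = g 0" "h 1 = h 0"
    and pos: "\<And>t. t \<in> {0..1} \<Longrightarrow> Re (g t * cnj (h t)) > 0"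
  shows "winding_number h 0 = winding_number g 0"
proof (rule winding_number_loops_linear_eq)
  fix t :: real assume t: "t \<in> {0..1}"
  show "0 \<notin> closed_segment (g t) (h t)"
  proof
    assume "0 \<in> closed_segment (g t) (h t)"
    then obtain u where u: "0 \<le> u" "u \<le> 1" "0 = (1 - u) *\<^sub>R g t + u *\<^sub>R h t"
      unfolding closed_segment_def by auto
    \<comment> \<open>Multiplying by \<open>cnj (h t)\<close> and taking real parts gives a
      vanishing sum of two nonnegative terms.\<close>
    then have "0 = Re (((1 - u) *\<^sub>R g t + u *\<^sub>R h t) * cnj (h t))"
      by simp
    also have "\<dots> = (1 - u) * Re (g t * cnj (h t)) + u * (cmod (h t))\<^sup>2"
      by (simp add: algebra_simps cmod_power2) (simp add: power2_eq_square)
    finally have e: "(1 - u) * Re (g t * cnj (h t)) + u * (cmod (h t))\<^sup>2 = 0" by simp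
    have "(1 - u) * Re (g t * cnj (h t)) \<ge> 0" "u * (cmod (h t))\<^sup>2 \<ge> 0"
      using u pos[OF t] by simp_all
    then have "(1 - u) * Re (g t * cnj (h t)) = 0" "u * (cmod (h t))\<^sup>2 = 0"
      using e by linarith+
    then have "u = 1" "h t = 0"
      using pos[OF t] by auto
    then show False using pos[OF t] by simp
  qed
qed (use assms in \<open>auto simp: pathfinish_def pathstart_def\<close>)

text \<open>
  For \<open>\<epsilon> \<rightarrow> 0\<close> the loops \<open>(A + i\<epsilon>A')(B + i\<epsilon>B')\<close> and \<open>AB + i\<epsilon>(AB)'\<close> differ by \<open>O(\<epsilon>\<^sup>2)\<close>,
  whereas the latter stays at distance at least of order \<open>\<epsilon>\<close> from \<open>0\<close>. Rescaling the
  imaginary part by \<open>\<epsilon>\<close> does not change winding numbers.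
\<close>

lemma winding_number_jet_mult:
  fixes A A' B B' :: "real \<Rightarrow> real"
  assumes cont: "continuous_on {0..1} A" "continuous_on {0..1} A'"
      "continuous_on {0..1} B" "continuous_on {0..1} B'"
    and loop: "A 1 = A 0" "A' 1 = A' 0" "B 1 = B 0" "B' 1 = B' 0"
    and nz: "\<And>t. t \<in> {0..1} \<Longrightarrow> (A t * B t, A' t * B t + A t * B' t) \<noteq> (0, 0)"
  shows "winding_number (\<lambda>t. Complex (A t * B t) (A' t * B t + A t * B' t)) 0
    = winding_number (\<lambda>t. Complex (A t) (A' t)) 0 + winding_number (\<lambda>t. Complex (B t) (B' t)) 0"
proof -
  define C C' where "C = (\<lambda>t. A t * B t)" and "C' = (\<lambda>t. A' t * B t + A t * B' t)"
  have contC: "continuous_on {0..1} C" "continuous_on {0..1} C'"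
    unfolding C_def C'_def by (intro continuous_intros cont)+
  have rescale: "winding_number (\<lambda>t. Complex (U t) (\<epsilon> * V t)) 0
      = winding_number (\<lambda>t. Complex (U t) (V t)) 0"
    if "continuous_on {0..1} U" "continuous_on {0..1} V" "U 1 = U 0" "V 1 = V 0" "\<epsilon> > 0"
      "\<And>t. t \<in> {0..1} \<Longrightarrow> (U t, V t) \<noteq> (0, 0)" for U V :: "real \<Rightarrow> real" and \<epsilon>
  proof (rule winding_number_eq_if_Re_pos)
    fix t :: real assume "t \<in> {0..1}"
    then have "U t \<noteq> 0 \<or> V t \<noteq> 0" using that(6) by auto
    then have "(U t)\<^sup>2 + \<epsilon> * (V t)\<^sup>2 > 0"
      using \<open>\<epsilon> > 0\<close> by (auto intro: add_pos_nonneg add_nonneg_pos)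
    then show "Re (Complex (U t) (V t) * cnj (Complex (U t) (\<epsilon> * V t))) > 0"
      by (simp add: power2_eq_square mult_ac)
  qed (use that in \<open>auto simp: path_def Complex_eq intro!: continuous_intros\<close>)
  obtain t0 where t0: "t0 \<in> {0..1}" "\<And>t. t \<in> {0..1} \<Longrightarrow>
      cmod (Complex (C t0) (C' t0)) \<le> cmod (Complex (C t) (C' t))"
    using continuous_attains_inf[of "{0..1::real}" "\<lambda>t. cmod (Complex (C t) (C' t))"] contC
    by (force simp: Complex_eq intro!: continuous_intros)
  define \<delta> where "\<delta> = cmod (Complex (C t0) (C' t0))"
  have "\<delta> > 0" using nz[OF t0(1)] by (auto simp: \<delta>_def C_def C'_def complex_eq_iff)
  obtain t1 where t1: "t1 \<in> {0..1}" "\<And>t. t \<in> {0..1} \<Longrightarrow> \<bar>A' t * B' t\<bar> \<le> \<bar>A' t1 * B' t1\<bar>"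
    using continuous_attains_sup[of "{0..1::real}" "\<lambda>t. \<bar>A' t * B' t\<bar>"] cont
    by (force intro!: continuous_intros)
  \<comment> \<open>The summand 1 makes the bound strict, and \<open>M\<close> positive even if
    \<open>A' * B'\<close> vanishes identically.\<close>
  define M where "M = \<bar>A' t1 * B' t1\<bar> + 1"
  have M: "M > 0" "\<And>t. t \<in> {0..1} \<Longrightarrow> \<bar>A' t * B' t\<bar> < M"
    using t1(2) by (fastforce simp: M_def)+
  \<comment> \<open>The bound \<open>\<delta> / M\<close> keeps the error
    \<open>\<epsilon>\<^sup>2 * M\<close> below \<open>\<epsilon> * \<delta>\<close>; the bound 1
    allows \<open>\<epsilon> * C t\<close> to be replaced by \<open>C t\<close> in the norm.\<close>
  define \<epsilon> where "\<epsilon> = min 1 (\<delta> / M)"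
  have \<epsilon>: "\<epsilon> > 0" "\<epsilon> \<le> 1" "\<epsilon> * M \<le> \<delta>"
    using \<open>\<delta> > 0\<close> M(1) by (auto simp: \<epsilon>_def min_def field_simps)
  have "winding_number (\<lambda>t. Complex (A t) (\<epsilon> * A' t) * Complex (B t) (\<epsilon> * B' t)) 0
      = winding_number (\<lambda>t. Complex (C t) (\<epsilon> * C' t)) 0"
  proof (rule winding_number_nearby_loops_eq)
    fix t :: real assume t: "t \<in> {0..1}"
    have "Complex (A t) (\<epsilon> * A' t) * Complex (B t) (\<epsilon> * B' t) - Complex (C t) (\<epsilon> * C' t)
        = of_real (- \<epsilon>\<^sup>2 * (A' t * B' t))"
      by (simp add: complex_eq_iff C_def C'_def power2_eq_square algebra_simps)
    then have "cmod (Complex (A t) (\<epsilon> * A' t) * Complex (B t) (\<epsilon> * B' t) - Complex (C t) (\<epsilon> * C' t))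
        = \<epsilon>\<^sup>2 * \<bar>A' t * B' t\<bar>"
      by (simp only: norm_of_real) (simp add: abs_mult)
    also have "\<dots> < \<epsilon>\<^sup>2 * M"
      using M(2)[OF t] \<epsilon>(1) by (intro mult_strict_left_mono) auto
    also have "\<dots> \<le> \<epsilon> * \<delta>"
      using \<epsilon> by (simp add: power2_eq_square)
    also have "\<dots> \<le> \<epsilon> * cmod (Complex (C t) (C' t))"
      using t0(2)[OF t] \<epsilon>(1) by (simp add: \<delta>_def)
    also have "\<dots> = cmod (Complex (\<epsilon> * C t) (\<epsilon> * C' t))"
    proof -
      have "Complex (\<epsilon> * C t) (\<epsilon> * C' t) = of_real \<epsilon> * Complex (C t) (C' t)"
        by (simp add: complex_eq_iff)
      then show ?thesis using \<epsilon>(1) by (simp add: norm_mult)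
    qed
    also have "\<dots> \<le> cmod (Complex (C t) (\<epsilon> * C' t))"
    proof -
      have "(\<epsilon> * C t)\<^sup>2 \<le> (C t)\<^sup>2"
        using \<epsilon> by (simp add: power_mult_distrib mult_left_le_one_le power_le_one)
      then show ?thesis by (simp add: complex_norm)
    qed
    finally show "cmod (Complex (A t) (\<epsilon> * A' t) * Complex (B t) (\<epsilon> * B' t) - Complex (C t) (\<epsilon> * C' t))
        < cmod (Complex (C t) (\<epsilon> * C' t) - 0)" by simp
  qed (use cont contC loop in \<open>auto simp: path_def Complex_eq pathstart_def pathfinish_def C_def C'_def
      intro!: continuous_intros\<close>)
  \<comment> \<open>A common zero of \<open>A\<close> and \<open>A'\<close> would be one of
    \<open>C\<close> and \<open>C'\<close>; likewise for \<open>B\<close> and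
    \<open>B'\<close>.\<close>
  moreover have nzA: "(A t, A' t) \<noteq> (0, 0)" and nzB: "(B t, B' t) \<noteq> (0, 0)"
    if "t \<in> {0..1}" for t
    using nz[OF that] by auto
  have "winding_number (\<lambda>t. Complex (A t) (\<epsilon> * A' t) * Complex (B t) (\<epsilon> * B' t)) 0
      = winding_number (\<lambda>t. Complex (A t) (\<epsilon> * A' t)) 0 + winding_number (\<lambda>t. Complex (B t) (\<epsilon> * B' t)) 0"
    using nzA nzB \<epsilon>(1) cont by (intro winding_number_mult)
      (auto simp: path_def path_image_def Complex_eq complex_eq_iff intro!: continuous_intros)
  ultimately have "winding_number (\<lambda>t. Complex (C t) (\<epsilon> * C' t)) 0
      = winding_number (\<lambda>t. Complex (A t) (\<epsilon> * A' t)) 0 + winding_number (\<lambda>t. Complex (B t) (\<epsilon> * B' t)) 0"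
    by simp
  moreover have "winding_number (\<lambda>t. Complex (A t) (\<epsilon> * A' t)) 0 = winding_number (\<lambda>t. Complex (A t) (A' t)) 0"
    using cont loop nzA \<epsilon>(1) by (intro rescale) auto
  moreover have "winding_number (\<lambda>t. Complex (B t) (\<epsilon> * B' t)) 0 = winding_number (\<lambda>t. Complex (B t) (B' t)) 0"
    using cont loop nzB \<epsilon>(1) by (intro rescale) auto
  moreover have "winding_number (\<lambda>t. Complex (C t) (\<epsilon> * C' t)) 0 = winding_number (\<lambda>t. Complex (C t) (C' t)) 0"
    using contC loop nz \<epsilon>(1) by (intro rescale) (auto simp: C_def C'_def)
  ultimately show ?thesis by (simp add: C_def C'_def)
qed

subsection \<open>Inequalities\<close>

text \<open>
  With \<open>v = exp (2\<tau>)\<close> the following is \<open>cosh (n\<tau>)\<^sup>2 > n(2n-1) sinh (\<tau>)\<^sup>2\<close>; it is proved by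
  expanding \<open>v ^ n + v ^ -n\<close> up to second order in \<open>D = v + 1/v - 2\<close>.
\<close>

lemma cosh_expansion_lower_bound:
  fixes v :: real
  assumes "v > 0"
  defines "D \<equiv> v + 1 / v - 2"
  defines "c \<equiv> \<lambda>n. v ^ n + 1 / v ^ n"
  shows "c n \<ge> 2 + n\<^sup>2 * D + n\<^sup>2 * (n\<^sup>2 - 1) / 12 * D\<^sup>2"
proof -
  define p where "p = (\<lambda>x::real. 2 + x\<^sup>2 * D + x\<^sup>2 * (x\<^sup>2 - 1) / 12 * D\<^sup>2)"
  have D: "D = (v - 1)\<^sup>2 / v"
    using assms(1) by (simp add: D_def field_simps power2_eq_square)
  then have "D \<ge> 0" using assms(1) by simp
  \<comment> \<open>Since \<open>v + 1 / v = D + 2\<close>, the second difference of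
    \<open>c\<close> is \<open>D\<close> times its middle value.\<close>
  have rec: "c (Suc (Suc k)) - c (Suc k) = (c (Suc k) - c k) + D * c (Suc k)" for k
    using assms(1) by (simp add: c_def D_def field_simps)
  \<comment> \<open>Values and first differences are compared together, so that a bound on second
    differences propagates to both.\<close>
  have "c k \<ge> p k \<and> c (Suc k) - c k \<ge> p (Suc k) - p k" for k
  proof (induction k)
    case 0
    have "c 0 = 2" "c (Suc 0) = D + 2" by (simp_all add: c_def D_def)
    then show ?case by (simp add: p_def)
  next
    case (Suc k)
    then have 1: "c (Suc k) \<ge> p (Suc k)" by simp
    define x where "x = real (Suc k)"
    have "D * c (Suc k) \<ge> D * (2 + x\<^sup>2 * D)"
    proof (intro mult_left_mono)
      have "x \<ge> 1" by (simp add: x_def)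
      then have "x\<^sup>2 * (x\<^sup>2 - 1) / 12 * D\<^sup>2 \<ge> 0" by simp
      then show "2 + x\<^sup>2 * D \<le> c (Suc k)" using 1 unfolding p_def x_def by linarith
    qed (fact \<open>D \<ge> 0\<close>)
    \<comment> \<open>The second difference of \<open>x\<^sup>2\<close> is 2 and that of
      \<open>x\<^sup>2 * (x\<^sup>2 - 1) / 12\<close> is \<open>x\<^sup>2\<close>; hence the
      coefficients of \<open>p\<close>.\<close>
    moreover have "p (x + 1) - p x = (p x - p (x - 1)) + D * (2 + x\<^sup>2 * D)"
    proof -
      define K where "K = D\<^sup>2 / 12"
      have e1: "D * (2 + x\<^sup>2 * D) = 2 * D + 12 * (x\<^sup>2 * K)"
        by (simp add: K_def power2_eq_square algebra_simps)
      have e2: "p z = 2 + z\<^sup>2 * D + z\<^sup>2 * (z\<^sup>2 - 1) * K" for z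
        by (simp add: p_def K_def)
      show ?thesis unfolding e1 e2 by (simp add: power2_eq_square algebra_simps)
    qed
    moreover have "p (real (Suc (Suc k))) = p (x + 1)" "p (real k) = p (x - 1)" "p (real (Suc k)) = p x"
      by (simp_all add: x_def add_ac)
    ultimately have "c (Suc (Suc k)) - c (Suc k) \<ge> p (Suc (Suc k)) - p (Suc k)"
      using conjunct2[OF Suc] rec[of k] by linarith
    with 1 show ?case by simp
  qed
  then show ?thesis by (simp add: p_def)
qed

lemma power_times_diff_square_less_1:
  fixes v :: real
  assumes "v > 0" "n \<ge> 1"
  shows "real n * (2 * real n - 1) * v ^ n * (v - 1)\<^sup>2 < v * (v ^ n + 1)\<^sup>2"
proof -
  define D where "D = v + 1 / v - 2"
  define x where "x = real n"
  have x: "x \<ge> 1" using assms(2) by (simp add: x_def)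
  have c: "v ^ n + 1 / v ^ n \<ge> 2 + x\<^sup>2 * D + x\<^sup>2 * (x\<^sup>2 - 1) / 12 * D\<^sup>2"
    using cosh_expansion_lower_bound[OF assms(1), of n] by (simp add: D_def x_def)
  \<comment> \<open>The expression is the lower bound for \<open>v ^ n + 1 / v ^ n\<close>, plus 2,
    minus \<open>x * (2 * x - 1) * D\<close>. For \<open>x = 1\<close> only the constant 4
    remains.\<close>
  have "4 - x * (x - 1) * D + x\<^sup>2 * (x\<^sup>2 - 1) / 12 * D\<^sup>2 > 0"
  proof (cases "x = 1")
    case False
    then have "x > 1" using x by simp
    \<comment> \<open>Completing the square in \<open>D\<close>; the factor
      \<open>48 * (x + 1)\<close> clears denominators.\<close>
    have "48 * (x + 1) * (4 - x * (x - 1) * D + x\<^sup>2 * (x\<^sup>2 - 1) / 12 * D\<^sup>2)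
        = (x - 1) * (2 * x * (x + 1) * D - 12)\<^sup>2 + 48 * (x + 7)"
      by (simp add: power2_eq_square field_simps)
    also have "\<dots> > 0" using \<open>x > 1\<close> by (intro add_nonneg_pos) auto
    finally show ?thesis using \<open>x > 1\<close> by (simp add: zero_less_mult_iff)
  qed simp
  then have "x * (2 * x - 1) * D < v ^ n + 1 / v ^ n + 2"
    using c by (simp add: power2_eq_square algebra_simps)
  then have "x * (2 * x - 1) * D * (v * v ^ n) < (v ^ n + 1 / v ^ n + 2) * (v * v ^ n)"
    using assms(1) by (intro mult_strict_right_mono) auto
  moreover have "D * v = (v - 1)\<^sup>2"
    using assms(1) by (simp add: D_def field_simps power2_eq_square)
  moreover have "(v ^ n + 1 / v ^ n + 2) * v ^ n = (v ^ n + 1)\<^sup>2"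
    using assms(1) by (simp add: field_simps power2_eq_square)
  ultimately show ?thesis
    by (simp add: x_def mult_ac) (metis mult.assoc mult.left_commute)
qed

lemma power_times_diff_square_less:
  fixes a b :: real
  assumes "a > 0" "b > 0" "n \<ge> 1"
  shows "real n * (2 * real n - 1) * (a ^ n * b ^ n) * (a - b)\<^sup>2 < a * b * (a ^ n + b ^ n)\<^sup>2"
proof -
  define v where "v = a / b"
  have a: "a = v * b" and "v > 0" using assms by (simp_all add: v_def)
  have "real n * (2 * real n - 1) * v ^ n * (v - 1)\<^sup>2 * (b ^ n * b)\<^sup>2
      < v * (v ^ n + 1)\<^sup>2 * (b ^ n * b)\<^sup>2"
    using assms \<open>v > 0\<close> by (intro mult_strict_right_mono power_times_diff_square_less_1) auto
  then show ?thesis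
    by (simp add: a power_mult_distrib power2_eq_square algebra_simps)
qed

text \<open>By the parallelogram law two values alone force this much spread about any centre
  \<open>w\<close>. The first inequality is the case where \<open>w\<close> is the mean.\<close>

lemma sum_squares_minus_square_sum:
  fixes s :: "'a \<Rightarrow> real"
  assumes "finite A" "p \<in> A" "q \<in> A" "p \<noteq> q"
  shows "card A * (s p - s q)\<^sup>2 / 2 \<le> card A * (\<Sum>a\<in>A. (s a)\<^sup>2) - (\<Sum>a\<in>A. s a)\<^sup>2"
    and "(s p - s q)\<^sup>2 / 2 \<le> (\<Sum>a\<in>A. (s a - w)\<^sup>2)"
proof -
  show *: "(s p - s q)\<^sup>2 / 2 \<le> (\<Sum>a\<in>A. (s a - w)\<^sup>2)" for w
  proof -
    have "(\<Sum>a\<in>{p,q}. (s a - w)\<^sup>2) \<le> (\<Sum>a\<in>A. (s a - w)\<^sup>2)"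
      using assms by (intro sum_mono2) auto
    moreover have "2 * (s p - w)\<^sup>2 + 2 * (s q - w)\<^sup>2 = (s p - s q)\<^sup>2 + (s p + s q - 2 * w)\<^sup>2"
      by (simp add: power2_eq_square algebra_simps)
    moreover have "(s p + s q - 2 * w)\<^sup>2 \<ge> 0" by simp
    ultimately show ?thesis using assms(4) by (simp; linarith)
  qed
  define m where "m = real (card A)"
  have "m > 0" using assms by (auto simp: m_def card_gt_0_iff)
  define S1 S2 where "S1 = (\<Sum>a\<in>A. s a)" and "S2 = (\<Sum>a\<in>A. (s a)\<^sup>2)"
  have "(\<Sum>a\<in>A. (s a - S1 / m)\<^sup>2) = S2 - 2 * (S1 / m) * S1 + m * (S1 / m)\<^sup>2"
    by (simp add: power2_diff sum.distrib sum_subtractf S1_def S2_def m_def sum_distrib_left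
        sum_distrib_right sum_divide_distrib mult_ac)
  also have "\<dots> = S2 - S1\<^sup>2 / m"
    using \<open>m > 0\<close> by (simp add: field_simps power2_eq_square)
  finally have "m * ((s p - s q)\<^sup>2 / 2) \<le> m * (S2 - S1\<^sup>2 / m)"
    using *[of "S1 / m"] \<open>m > 0\<close> by simp
  then show "card A * (s p - s q)\<^sup>2 / 2 \<le> card A * (\<Sum>a\<in>A. (s a)\<^sup>2) - (\<Sum>a\<in>A. s a)\<^sup>2"
    using \<open>m > 0\<close> by (simp add: m_def S1_def S2_def right_diff_distrib)
qed

lemma log_derivative_inequality:
  fixes s :: "real \<Rightarrow> real" and x y :: real
  assumes "finite A" "1 \<in> A" "-1 \<in> A" "n \<ge> 1" "x \<noteq> 0" "y \<noteq> 0"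
    and xy: "x - y \<noteq> 0" "x + y \<noteq> 0" and s: "s 1 = x / (x - y)" "s (-1) = x / (x + y)"
  defines "N \<equiv> 2 * real n" and "m \<equiv> real (card A)"
    and "w \<equiv> x ^ (2 * n) / (x ^ (2 * n) + y ^ (2 * n))"
  shows "((\<Sum>a\<in>A. s a) + N * w)\<^sup>2 < (N + m) * ((\<Sum>a\<in>A. (s a)\<^sup>2) - N * (N - 1) * w + N\<^sup>2 * w\<^sup>2)"
proof -
  define S1 S2 where "S1 = (\<Sum>a\<in>A. s a)" and "S2 = (\<Sum>a\<in>A. (s a)\<^sup>2)"
  define \<delta> where "\<delta> = (s 1 - s (-1))\<^sup>2"
  have N: "N \<ge> 2" using assms(4) by (simp add: N_def)
  have m0: "m \<ge> 0" by (simp add: m_def)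
  have 1: "m * \<delta> / 2 \<le> m * S2 - S1\<^sup>2"
    using sum_squares_minus_square_sum(1)[of A 1 "-1" s] assms
    by (simp add: \<delta>_def m_def S1_def S2_def)
  have "(\<Sum>a\<in>A. (s a - w)\<^sup>2) = S2 - 2 * w * S1 + m * w\<^sup>2"
    by (simp add: power2_diff sum.distrib sum_subtractf S1_def S2_def m_def sum_distrib_left
        sum_distrib_right mult_ac)
  then have 2: "\<delta> / 2 \<le> S2 - 2 * w * S1 + m * w\<^sup>2"
    using sum_squares_minus_square_sum(2)[of A 1 "-1" s w] assms by (simp add: \<delta>_def)
  have pos: "x\<^sup>2 > 0" "y\<^sup>2 > 0" "x ^ (2 * n) > 0" "y ^ (2 * n) > 0"
    using assms by (auto simp: power_mult)
  have nz: "x\<^sup>2 - y\<^sup>2 \<noteq> 0" using xy by (simp add: power2_eq_square square_diff_square_factored)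
  have \<delta>: "\<delta> = 4 * x\<^sup>2 * y\<^sup>2 / (x\<^sup>2 - y\<^sup>2)\<^sup>2"
  proof -
    have "s 1 - s (-1) = 2 * x * y / (x\<^sup>2 - y\<^sup>2)"
      using xy nz unfolding s by (simp add: field_simps power2_eq_square)
    then show ?thesis by (simp add: \<delta>_def power_divide power_mult_distrib)
  qed
  define P Q Z where "P = x ^ (2 * n)" and "Q = y ^ (2 * n)" and "Z = x\<^sup>2 - y\<^sup>2"
  have PQ: "P > 0" "Q > 0" "Z \<noteq> 0" using pos nz by (simp_all add: P_def Q_def Z_def)
  have w: "w * (1 - w) = P * Q / (P + Q)\<^sup>2"
  proof -
    have "w = P / (P + Q)" by (simp add: w_def P_def Q_def)
    moreover from this have "1 - w = Q / (P + Q)" using PQ by (simp add: field_simps)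
    ultimately show ?thesis by (simp add: power2_eq_square)
  qed
  \<comment> \<open>The inequality for powers at \<open>x\<^sup>2\<close> and
    \<open>y\<^sup>2\<close>, doubled because \<open>N * (N - 1)\<close> is
    \<open>2 * n * (2 * n - 1)\<close>.\<close>
  have "N * (N - 1) * (P * Q) * Z\<^sup>2 < 2 * (x\<^sup>2 * y\<^sup>2) * (P + Q)\<^sup>2"
    using power_times_diff_square_less[OF pos(1,2) assms(4)]
    by (simp add: power_mult P_def Q_def Z_def N_def)
  moreover have "A / C < B / E" if "A * E < B * C" "C > 0" "E > 0" for A B C E :: real
    using that by (simp add: field_simps)
  ultimately have "N * (N - 1) * (P * Q) / (P + Q)\<^sup>2 < 2 * (x\<^sup>2 * y\<^sup>2) / Z\<^sup>2"
    using PQ by simp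
  then have "N * (N - 1) * (w * (1 - w)) < \<delta> / 2"
    unfolding w \<delta> Z_def by simp
  \<comment> \<open>Of the \<open>N + m\<close> copies of \<open>\<delta> / 2\<close>,
    \<open>m\<close> are covered by \<open>m * S2 - S1\<^sup>2\<close> and \<open>N\<close> by the
    spread about \<open>w\<close>.\<close>
  then have "(N + m) * (N * (N - 1) * (w * (1 - w))) < (N + m) * (\<delta> / 2)"
    using N m0 by (intro mult_strict_left_mono) auto
  also have "\<dots> = m * \<delta> / 2 + N * (\<delta> / 2)" by (simp add: algebra_simps)
  also have "\<dots> \<le> (m * S2 - S1\<^sup>2) + N * (S2 - 2 * w * S1 + m * w\<^sup>2)"
    using 1 2 N by (intro add_mono mult_left_mono) auto
  finally have "(S1 + N * w)\<^sup>2 < (N + m) * (S2 - N * (N - 1) * w + N\<^sup>2 * w\<^sup>2)"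
    by (simp add: power2_eq_square algebra_simps)
  then show ?thesis by (simp add: S1_def S2_def)
qed

subsection \<open>The index of a hyperbolic polynomial\<close>

text \<open>
  On the unit circle, \<open>rot f\<close> is the derivative \<open>F'\<close> of \<open>F \<phi> = f (cos \<phi>, sin \<phi>)\<close>.
\<close>

definition rot :: "bipoly \<Rightarrow> bipoly" where
  "rot f = X * pderiv_y f - Y * pderiv_x f"

text \<open>This is the condition for the loop \<open>F + i F'\<close> to avoid 0.\<close>

definition simple_zeros :: "bipoly \<Rightarrow> bool" where
  "simple_zeros f \<longleftrightarrow>
     (\<forall>x y. (x, y) \<noteq> (0, 0) \<longrightarrow> eval2 f x y \<noteq> 0 \<or> eval2 (rot f) x y \<noteq> 0)"

text \<open>At each simple zero of \<open>F\<close> the loop \<open>F + i F'\<close> crosses the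
  imaginary axis clockwise, so this counts real zero lines negatively.\<close>

definition jet_index :: "bipoly \<Rightarrow> complex" where
  "jet_index f = winding_number (\<lambda>t. Complex (eval2 f (cos (2 * pi * t)) (sin (2 * pi * t)))
     (eval2 (rot f) (cos (2 * pi * t)) (sin (2 * pi * t)))) 0"

lemma rot_mult: "rot (f * g) = rot f * g + f * rot g"
  by (simp add: rot_def pderiv_x_mult pderiv_y_mult algebra_simps)

lemma cos_sin_neq_0: "(cos t, sin t) \<noteq> (0 :: real, 0 :: real)"
  by (metis prod.inject sin_zero_abs_cos_one abs_zero zero_neq_one)

lemma continuous_on_eval2 [continuous_intros]:
  assumes "continuous_on S u" "continuous_on S v"
  shows "continuous_on S (\<lambda>t. eval2 f (u t) (v t))"
  by (induction f) (auto simp: eval2_pCons intro!: continuous_intros assms)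

lemma path_Complex:
  assumes "continuous_on {0..1} u" "continuous_on {0..1} v"
  shows "path (\<lambda>t. Complex (u t) (v t))"
  using assms by (auto simp: path_def Complex_eq intro!: continuous_intros)

text \<open>\<open>rot\<close> is a derivation, so \<open>winding_number_jet_mult\<close> applies
  along the circle.\<close>

lemma jet_index_mult:
  assumes "simple_zeros (f * g)"
  shows "jet_index (f * g) = jet_index f + jet_index g"
proof -
  define x y where "x = (\<lambda>t::real. cos (2 * pi * t))" and "y = (\<lambda>t::real. sin (2 * pi * t))"
  have c: "continuous_on {0..1} x" "continuous_on {0..1} y"
    unfolding x_def y_def by (intro continuous_intros)+
  have "winding_number (\<lambda>t. Complex (eval2 f (x t) (y t) * eval2 g (x t) (y t))
        (eval2 (rot f) (x t) (y t) * eval2 g (x t) (y t) +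
         eval2 f (x t) (y t) * eval2 (rot g) (x t) (y t))) 0
      = winding_number (\<lambda>t. Complex (eval2 f (x t) (y t)) (eval2 (rot f) (x t) (y t))) 0
      + winding_number (\<lambda>t. Complex (eval2 g (x t) (y t)) (eval2 (rot g) (x t) (y t))) 0"
  proof (rule winding_number_jet_mult)
    fix t :: real
    have "(x t, y t) \<noteq> (0, 0)" using cos_sin_neq_0 by (simp add: x_def y_def)
    then show "(eval2 f (x t) (y t) * eval2 g (x t) (y t),
        eval2 (rot f) (x t) (y t) * eval2 g (x t) (y t) +
        eval2 f (x t) (y t) * eval2 (rot g) (x t) (y t)) \<noteq> (0, 0)"
      using assms by (auto simp: simple_zeros_def rot_mult)
  qed (intro continuous_intros c | simp add: x_def y_def)+
  then show ?thesis by (simp add: jet_index_def rot_mult x_def y_def)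
qed

text \<open>The loop stays in the open right half-plane, hence is comparable with the constant
  1.\<close>

lemma jet_index_pos:
  assumes "\<And>x y. (x, y) \<noteq> (0, 0) \<Longrightarrow> eval2 f x y > 0"
  shows "jet_index f = 0"
proof -
  have "winding_number (\<lambda>t. Complex (eval2 f (cos (2 * pi * t)) (sin (2 * pi * t)))
     (eval2 (rot f) (cos (2 * pi * t)) (sin (2 * pi * t)))) 0
    = winding_number (\<lambda>t. 1) 0"
  proof (rule winding_number_eq_if_Re_pos)
    fix t :: real
    show "0 < Re (1 * cnj (Complex (eval2 f (cos (2 * pi * t)) (sin (2 * pi * t)))
                     (eval2 (rot f) (cos (2 * pi * t)) (sin (2 * pi * t)))))"
      using assms[OF cos_sin_neq_0] by simp
  qed (auto intro!: path_Complex continuous_intros simp: path_def)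
  also have "\<dots> = 0"
    using winding_number_exp[of "\<lambda>t. 0" "\<lambda>t. 1"] by (simp add: path_def)
  finally show ?thesis by (simp add: jet_index_def)
qed

lemma Complex_cos_sin: "Complex (cos t) (sin t) = exp (\<i> * of_real t)"
  by (simp add: complex_eq_iff exp_Euler cos_of_real sin_of_real)

text \<open>The loop is \<open>(\<alpha> + i \<beta>) * (x - i y)\<close>, one clockwise
  turn.\<close>

lemma jet_index_linear:
  assumes lin: "\<And>x y. eval2 f x y = \<alpha> * x + \<beta> * y" "\<And>x y. eval2 (rot f) x y = \<beta> * x - \<alpha> * y"
    and nz: "(\<alpha>, \<beta>) \<noteq> (0, 0)"
  shows "jet_index f = -1"
proof -
  define l where "l = Ln (Complex \<alpha> \<beta>)"
  have l: "exp l = Complex \<alpha> \<beta>" using nz by (simp add: l_def exp_Ln complex_eq_iff)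
  have "jet_index f = ((l - \<i> * of_real (2 * pi * 1)) - (l - \<i> * of_real (2 * pi * 0)))
      / (2 * of_real pi * \<i>)"
    unfolding jet_index_def
  proof (rule winding_number_exp)
    fix t :: real
    have "exp (l - \<i> * of_real (2 * pi * t))
        = Complex \<alpha> \<beta> * Complex (cos (2 * pi * t)) (- sin (2 * pi * t))"
      using Complex_cos_sin[of "- (2 * pi * t)"] by (simp add: exp_diff l exp_minus divide_inverse)
    then show "Complex (eval2 f (cos (2 * pi * t)) (sin (2 * pi * t)))
        (eval2 (rot f) (cos (2 * pi * t)) (sin (2 * pi * t)))
      = exp (l - \<i> * of_real (2 * pi * t))"
      by (simp add: complex_eq_iff lin)
  qed (auto simp: path_def intro!: continuous_intros)
  also have "\<dots> = -1" by (simp add: field_simps)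
  finally show ?thesis .
qed

text \<open>
  In the rotated frame \<open>(cos \<phi>, sin \<phi>), (-sin \<phi>, cos \<phi>)\<close> the second derivative of \<open>f\<close> has entries
  \<open>p, q, r\<close>, and \<open>a - c + 2bi = e\<^bsup>2i\<phi>\<^esup> (p - r + 2qi)\<close>. By Euler's identity \<open>p = d(d-1) F\<close> and
  \<open>q = (d-1) F'\<close>, so that \<open>pr \<le> q\<^sup>2\<close> keeps \<open>p - r + 2qi\<close> from ever being a negative multiple of
  \<open>F + i F'\<close>.
\<close>

lemma Ind_gamma_eq:
  assumes hom: "homogeneous d f" and "d \<ge> 2"
    and hess: "\<And>x y. (x, y) \<noteq> (0, 0) \<Longrightarrow> eval2 (hessian f) x y \<le> 0"
    and simp: "simple_zeros f"
  shows "Ind (gamma f) = 2 + jet_index f"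
proof -
  define x y where "x = (\<lambda>t::real. cos (2 * pi * t))" and "y = (\<lambda>t::real. sin (2 * pi * t))"
  define a b c where "a = (\<lambda>t. eval2 (pderiv_x (pderiv_x f)) (x t) (y t))"
    and "b = (\<lambda>t. eval2 (pderiv_y (pderiv_x f)) (x t) (y t))"
    and "c = (\<lambda>t. eval2 (pderiv_y (pderiv_y f)) (x t) (y t))"
  define F F' where "F = (\<lambda>t. eval2 f (x t) (y t))" and "F' = (\<lambda>t. eval2 (rot f) (x t) (y t))"
  define p q r where "p = (\<lambda>t. a t * (x t)\<^sup>2 + 2 * b t * x t * y t + c t * (y t)\<^sup>2)"
    and "q = (\<lambda>t. (c t - a t) * x t * y t + b t * ((x t)\<^sup>2 - (y t)\<^sup>2))"
    and "r = (\<lambda>t. a t * (y t)\<^sup>2 - 2 * b t * x t * y t + c t * (x t)\<^sup>2)"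
  note defs = a_def b_def c_def F_def F'_def p_def q_def r_def
  have xy: "(x t)\<^sup>2 + (y t)\<^sup>2 = 1" for t by (simp add: x_def y_def)
  have cont: "continuous_on {0..1} x" "continuous_on {0..1} y"
    unfolding x_def y_def by (intro continuous_intros)+
  have cont': "continuous_on {0..1} p" "continuous_on {0..1} q" "continuous_on {0..1} r"
    "continuous_on {0..1} F" "continuous_on {0..1} F'"
    unfolding defs by (intro continuous_intros cont)+
  have loop: "x 1 = x 0" "y 1 = y 0" by (simp_all add: x_def y_def)
  define D where "D = real d"
  have D: "D \<ge> 2" using assms(2) by (simp add: D_def)
  have pF: "p t = D * (D - 1) * F t" and qF: "q t = (D - 1) * F' t" for t
  proof -
    note E = euler_eval[OF hom, of "x t" "y t", folded a_def b_def c_def F_def D_def]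
    have E': "x t * a t + y t * b t = (D - 1) * eval2 (pderiv_x f) (x t) (y t)"
      "x t * b t + y t * c t = (D - 1) * eval2 (pderiv_y f) (x t) (y t)"
      using E(2,3) by (simp_all add: a_def b_def c_def)
    have "p t = x t * (x t * a t + y t * b t) + y t * (x t * b t + y t * c t)"
      by (simp add: p_def power2_eq_square algebra_simps)
    also have "\<dots> = (D - 1) * (x t * eval2 (pderiv_x f) (x t) (y t) + y t * eval2 (pderiv_y f) (x t) (y t))"
      unfolding E' by (simp add: algebra_simps)
    also have "\<dots> = D * (D - 1) * F t"
      unfolding euler_eval(1)[OF hom] by (simp add: F_def D_def)
    finally show "p t = D * (D - 1) * F t" .
    have "q t = x t * (x t * b t + y t * c t) - y t * (x t * a t + y t * b t)"
      by (simp add: q_def power2_eq_square algebra_simps)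
    also have "\<dots> = (D - 1) * F' t"
      unfolding E' by (simp add: F'_def rot_def algebra_simps)
    finally show "q t = (D - 1) * F' t" .
  qed
  \<comment> \<open>This is the real part of \<open>p - r + 2qi\<close> times the conjugate of
    \<open>F + i F'\<close>. Scaled by \<open>D * (D - 1)\<close> it becomes
    \<open>p\<^sup>2 - p r + 2 D q\<^sup>2\<close>, which is at least
    \<open>p\<^sup>2 + (2 D - 1) q\<^sup>2\<close>.\<close>
  have pos: "(p t - r t) * F t + 2 * q t * F' t > 0" for t
  proof -
    have "a t * c t - (b t)\<^sup>2 \<le> 0"
      using hess[of "x t" "y t"] cos_sin_neq_0[of "2 * pi * t"]
      by (simp add: eval2_hessian a_def b_def c_def x_def y_def)
    moreover have "p t * r t - (q t)\<^sup>2 = (a t * c t - (b t)\<^sup>2) * ((x t)\<^sup>2 + (y t)\<^sup>2)\<^sup>2"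
      by (simp add: p_def q_def r_def power2_eq_square algebra_simps)
    ultimately have "p t * r t \<le> (q t)\<^sup>2" by (simp add: xy)
    have "F t \<noteq> 0 \<or> F' t \<noteq> 0"
      using simp cos_sin_neq_0[of "2 * pi * t"]
      by (auto simp: simple_zeros_def F_def F'_def x_def y_def)
    then have "(p t)\<^sup>2 > 0 \<or> (q t)\<^sup>2 > 0" using D by (auto simp: pF qF)
    then have "(p t)\<^sup>2 + (2 * D - 1) * (q t)\<^sup>2 > 0"
      using D by (auto intro: add_pos_nonneg add_nonneg_pos)
    also have "\<dots> \<le> (p t)\<^sup>2 - p t * r t + 2 * D * (q t)\<^sup>2"
      using \<open>p t * r t \<le> (q t)\<^sup>2\<close> by (simp add: algebra_simps)
    also have "\<dots> = D * (D - 1) * ((p t - r t) * F t + 2 * q t * F' t)"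
      by (simp add: pF qF power2_eq_square algebra_simps)
    finally have "D * (D - 1) * ((p t - r t) * F t + 2 * q t * F' t) > 0" .
    moreover have "D * (D - 1) > 0" using D by simp
    ultimately show ?thesis using zero_less_mult_pos by blast
  qed
  define V where "V = (\<lambda>t. Complex (p t - r t) (2 * q t))"
  define R where "R = (\<lambda>t. (Complex (x t) (y t))\<^sup>2)"
  have "Complex (a t - c t) (2 * b t) = R t * V t" for t
  proof -
    \<comment> \<open>Powers of \<open>x\<^sup>2 + y\<^sup>2 = 1\<close> are inserted to make both
      sides equal as polynomials.\<close>
    have "(a t - c t) * ((x t)\<^sup>2 + (y t)\<^sup>2)\<^sup>2 = ((x t)\<^sup>2 - (y t)\<^sup>2) * (p t - r t) - 2 * x t * y t * (2 * q t)"
      "2 * b t * ((x t)\<^sup>2 + (y t)\<^sup>2)\<^sup>2 = ((x t)\<^sup>2 - (y t)\<^sup>2) * (2 * q t) + 2 * x t * y t * (p t - r t)"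
      by (simp_all add: p_def q_def r_def power2_eq_square algebra_simps)
    then show ?thesis
      unfolding xy by (simp add: R_def V_def complex_eq_iff power2_eq_square)
  qed
  then have "Ind (gamma f) = winding_number (\<lambda>t. R t * V t) 0"
    by (simp add: Ind_def gamma_def a_def b_def c_def x_def y_def)
  also have "\<dots> = winding_number R 0 + winding_number V 0"
  proof (rule winding_number_mult)
    show "path R" unfolding R_def path_def Complex_eq by (intro continuous_intros cont)
    show "path V" unfolding V_def by (intro path_Complex continuous_intros cont')
    have "R t \<noteq> 0" for t
    proof -
      have "Complex (x t) (y t) \<noteq> 0"
        using cos_sin_neq_0[of "2 * pi * t"] by (simp add: x_def y_def complex_eq_iff)
      then show ?thesis by (simp add: R_def)
    qed
    then show "0 \<notin> path_image R"
      by (metis imageE path_image_def)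
    show "0 \<notin> path_image V"
    proof
      assume "0 \<in> path_image V"
      then obtain t where "V t = 0" by (auto simp: path_image_def)
      then show False using pos[of t] by (simp add: V_def complex_eq_iff)
    qed
  qed
  also have "winding_number R 0 = (\<i> * of_real (4 * pi * 1) - \<i> * of_real (4 * pi * 0)) / (2 * of_real pi * \<i>)"
  proof (rule winding_number_exp)
    show "R t = exp (\<i> * of_real (4 * pi * t))" for t
      by (simp add: R_def x_def y_def Complex_cos_sin algebra_simps flip: exp_double)
  qed (auto simp: path_def intro!: continuous_intros)
  also have "\<dots> = 2" by (simp add: field_simps)
  also have "winding_number V 0 = winding_number (\<lambda>t. Complex (F t) (F' t)) 0"
  proof (rule winding_number_eq_if_Re_pos)
    fix t :: real
    show "Re (Complex (F t) (F' t) * cnj (V t)) > 0"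
      using pos[of t] by (simp add: V_def algebra_simps)
  qed (use loop in \<open>auto simp: V_def defs intro!: path_Complex continuous_intros cont cont'[unfolded defs]\<close>)
  also have "\<dots> = jet_index f" by (simp add: jet_index_def F_def F'_def x_def y_def)
  finally show ?thesis .
qed

subsection \<open>Products of a definite form and distinct real lines\<close>

text \<open>The parameter is the ratio \<open>x / y\<close> on the line: \<open>a = 0\<close> gives
  the y-axis, and the x-axis never occurs.\<close>

definition line :: "real \<Rightarrow> bipoly" where
  "line a = X - [:[:0, a:]:]"

definition even_powers :: "nat \<Rightarrow> bipoly" where
  "even_powers n = X ^ (2 * n) + Y ^ (2 * n)"

definition line_product :: "nat \<Rightarrow> real set \<Rightarrow> bipoly" where
  "line_product n A = even_powers n * (\<Prod>a\<in>A. line a)"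

lemma eval2_line [simp]: "eval2 (line a) x y = x - a * y"
  by (simp add: line_def)

lemma eval2_even_powers [simp]: "eval2 (even_powers n) x y = x ^ (2 * n) + y ^ (2 * n)"
  by (simp add: even_powers_def)

lemma pderiv_x_line [simp]: "pderiv_x (line a) = 1"
  by (simp add: line_def)

lemma pderiv_y_line [simp]: "pderiv_y (line a) = - [:[:a:]:]"
  by (simp add: line_def pderiv_pCons)

lemma eval2_rot_line [simp]: "eval2 (rot (line a)) x y = - a * x - y"
  by (simp add: rot_def)

lemma homogeneous_line: "homogeneous 1 (line a)"
  by (auto simp: homogeneous_def line_def X_def coeff_pCons split: nat.splits)

lemma homogeneous_line_product: "homogeneous (2 * n + card A) (line_product n A)"
proof -
  have "homogeneous (2 * n) (even_powers n)"
    using homogeneous_power[OF homogeneous_X, of "2 * n"] homogeneous_power[OF homogeneous_Y, of "2 * n"]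
    by (simp add: even_powers_def homogeneous_add)
  then show ?thesis
    unfolding line_product_def
    by (intro homogeneous_mult homogeneous_prod homogeneous_line)
qed

lemma even_powers_pos:
  assumes "(x, y) \<noteq> (0 :: real, 0 :: real)" "n \<ge> 1"
  shows "x ^ (2 * n) + y ^ (2 * n) > 0"
proof -
  have "x\<^sup>2 > 0 \<or> y\<^sup>2 > 0" using assms(1) by auto
  then have "x ^ (2 * n) > 0 \<or> y ^ (2 * n) > 0" by (auto simp: power_mult)
  then show ?thesis by (auto intro: add_pos_nonneg add_nonneg_pos)
qed

section \<open>Simple zeros and jet index of products of lines\<close>

text \<open>At a zero of one factor the product rule leaves its \<open>rot\<close> times the other,
  nonvanishing factor.\<close>

lemma simple_zeros_mult:
  assumes "simple_zeros f" "simple_zeros g"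
    and "\<And>x y. (x, y) \<noteq> (0, 0) \<Longrightarrow> eval2 f x y \<noteq> 0 \<or> eval2 g x y \<noteq> 0"
  shows "simple_zeros (f * g)"
  unfolding simple_zeros_def rot_mult
proof (intro allI impI)
  fix x y :: real assume "(x, y) \<noteq> (0, 0)"
  then show "eval2 (f * g) x y \<noteq> 0 \<or> eval2 (rot f * g + f * rot g) x y \<noteq> 0"
    using assms by (cases "eval2 f x y = 0"; cases "eval2 g x y = 0") (auto simp: simple_zeros_def)
qed

lemma simple_zeros_prod_line: "finite A \<Longrightarrow> simple_zeros (\<Prod>a\<in>A. line a)"
proof (induction A rule: finite_induct)
  case empty
  then show ?case by (simp add: simple_zeros_def)
next
  case (insert a A)
  have "simple_zeros (line a * (\<Prod>a\<in>A. line a))"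
  proof (intro simple_zeros_mult insert.IH)
    show "simple_zeros (line a)"
      unfolding simple_zeros_def
    proof (intro allI impI)
      fix x y :: real assume xy: "(x, y) \<noteq> (0, 0)"
      show "eval2 (line a) x y \<noteq> 0 \<or> eval2 (rot (line a)) x y \<noteq> 0"
      proof (rule ccontr)
        assume "\<not> ?thesis"
        \<comment> \<open>Two linear equations with determinant \<open>1 + a\<^sup>2\<close>, hence
          only the zero solution.\<close>
        then have "x = a * y" "a * x + y = 0" by simp_all
        then have "y * (1 + a\<^sup>2) = 0" by (simp add: power2_eq_square algebra_simps)
        moreover have "1 + a\<^sup>2 > 0" by (simp add: add_pos_nonneg)
        ultimately show False using xy \<open>x = a * y\<close> by simp
      qed
    qed
    fix x y :: real assume "(x, y) \<noteq> (0, 0)"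
    then show "eval2 (line a) x y \<noteq> 0 \<or> eval2 (\<Prod>a\<in>A. line a) x y \<noteq> 0"
      using insert.hyps by (auto simp: eval2_prod)
  qed
  with insert.hyps show ?case by simp
qed

lemma simple_zeros_line_product:
  assumes "finite A" "n \<ge> 1"
  shows "simple_zeros (line_product n A)"
  unfolding line_product_def
proof (intro simple_zeros_mult simple_zeros_prod_line assms(1))
  show "simple_zeros (even_powers n)"
    using even_powers_pos[OF _ assms(2)] by (simp add: simple_zeros_def less_imp_neq[symmetric])
qed (use even_powers_pos[OF _ assms(2)] in \<open>simp add: less_imp_neq[symmetric]\<close>)

lemma jet_index_prod_line: "finite A \<Longrightarrow> jet_index (\<Prod>a\<in>A. line a) = - of_nat (card A)"
proof (induction A rule: finite_induct)
  case empty
  then show ?case by (simp add: jet_index_pos)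
next
  case (insert a A)
  have "jet_index (line a) = -1"
    by (rule jet_index_linear[where \<alpha> = 1 and \<beta> = "- a"]) simp_all
  then show ?case
    using insert jet_index_mult[of "line a" "\<Prod>a\<in>A. line a"]
      simple_zeros_prod_line[of "insert a A"] by simp
qed

lemma jet_index_line_product:
  assumes "finite A" "n \<ge> 1"
  shows "jet_index (line_product n A) = - of_nat (card A)"
proof -
  have "jet_index (even_powers n) = 0"
    using even_powers_pos[OF _ assms(2)] by (intro jet_index_pos) simp
  then show ?thesis
    using jet_index_mult simple_zeros_line_product[OF assms] jet_index_prod_line[OF assms(1)]
    by (simp add: line_product_def)
qed

section \<open>Sign of the Hessian on the zero lines, off the axes and on the axes\<close>

text \<open>Where \<open>f\<close> vanishes, the two Hessian formulas add up to
  \<open>- (d - 1)\<^sup>2\<close> times the squared gradient, which is nonzero because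
  \<open>rot f\<close> is.\<close>

lemma hessian_neg_at_zero:
  assumes hom: "homogeneous d f" and "d \<ge> 2" and simp: "simple_zeros f"
    and xy: "(x, y) \<noteq> (0, 0)" and zero: "eval2 f x y = 0"
  shows "eval2 (hessian f) x y < 0"
proof -
  define u v where "u = eval2 (pderiv_x f) x y" and "v = eval2 (pderiv_y f) x y"
  have 1: "x * u + y * v = 0" using euler_eval(1)[OF hom] zero by (simp add: u_def v_def)
  have 2: "x * v - y * u \<noteq> 0"
    using simp xy zero by (auto simp: simple_zeros_def rot_def u_def v_def)
  have D: "(real d - 1)\<^sup>2 > 0" using assms(2) by simp
  have X: "x\<^sup>2 * eval2 (hessian f) x y = - ((real d - 1)\<^sup>2 * v\<^sup>2)"
    using hessian_via_y[OF hom] zero by (simp add: v_def power2_eq_square)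
  have Y: "y\<^sup>2 * eval2 (hessian f) x y = - ((real d - 1)\<^sup>2 * u\<^sup>2)"
    using hessian_via_x[OF hom] zero by (simp add: u_def power2_eq_square)
  have "u\<^sup>2 + v\<^sup>2 > 0"
    using 2 by (auto simp: sum_power2_gt_zero_iff)
  then have "(real d - 1)\<^sup>2 * (u\<^sup>2 + v\<^sup>2) > 0" using D by simp
  then have "(x\<^sup>2 + y\<^sup>2) * eval2 (hessian f) x y < 0"
    using X Y by (simp add: algebra_simps)
  moreover have "x\<^sup>2 + y\<^sup>2 \<ge> 0" by simp
  ultimately show ?thesis by (simp add: mult_less_0_iff)
qed

text \<open>Factors with \<open>D (D (F a)) = 0\<close> have logarithmic derivatives
  \<open>t a\<close> with derivative \<open>- (t a)\<^sup>2\<close>. The derivation is abstract in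
  order to cover both partial derivatives.\<close>

lemma log_derivative_prod:
  fixes D :: "bipoly \<Rightarrow> bipoly"
  assumes mult: "\<And>f g. D (f * g) = D f * g + f * D g"
    and add: "\<And>f g. D (f + g) = D f + D g" and one: "D 1 = 0"
    and "finite A" "\<And>a. a \<in> A \<Longrightarrow> D (D (F a)) = 0" "\<And>a. a \<in> A \<Longrightarrow> eval2 (F a) x y \<noteq> 0"
  defines "t \<equiv> \<lambda>a. eval2 (D (F a)) x y / eval2 (F a) x y"
  shows "eval2 (D (prod F A)) x y = eval2 (prod F A) x y * (\<Sum>a\<in>A. t a)"
    and "eval2 (D (D (prod F A))) x y
      = eval2 (prod F A) x y * ((\<Sum>a\<in>A. t a)\<^sup>2 - (\<Sum>a\<in>A. (t a)\<^sup>2))"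
proof -
  have "eval2 (D (prod F A)) x y = eval2 (prod F A) x y * (\<Sum>a\<in>A. t a) \<and>
    eval2 (D (D (prod F A))) x y
      = eval2 (prod F A) x y * ((\<Sum>a\<in>A. t a)\<^sup>2 - (\<Sum>a\<in>A. (t a)\<^sup>2))"
    using assms(4-6)
  proof (induction A rule: finite_induct)
    case empty
    have "D 0 = 0" using add[of 0 0] by simp
    then show ?case by (simp add: one)
  next
    case (insert a A)
    then have IH: "eval2 (D (prod F A)) x y = eval2 (prod F A) x y * (\<Sum>a\<in>A. t a)"
      "eval2 (D (D (prod F A))) x y
        = eval2 (prod F A) x y * ((\<Sum>a\<in>A. t a)\<^sup>2 - (\<Sum>a\<in>A. (t a)\<^sup>2))"
      by auto
    have ta: "eval2 (D (F a)) x y = eval2 (F a) x y * t a" "D (D (F a)) = 0"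
      using insert.prems by (auto simp: t_def)
    show ?case
      using insert.hyps by (simp add: mult add IH ta power2_eq_square algebra_simps)
  qed
  then show "eval2 (D (prod F A)) x y = eval2 (prod F A) x y * (\<Sum>a\<in>A. t a)"
    and "eval2 (D (D (prod F A))) x y
      = eval2 (prod F A) x y * ((\<Sum>a\<in>A. t a)\<^sup>2 - (\<Sum>a\<in>A. (t a)\<^sup>2))" by blast+
qed

text \<open>For \<open>n = 1\<close> the exponent \<open>2 * n - 2\<close> is 0, so the second
  derivatives do not vanish on the axes; this causes the correction 2 in
  \<open>hessian_on_x_axis\<close>.\<close>

lemma eval2_derivs_even_powers:
  assumes "n \<ge> 1"
  shows "eval2 (pderiv_x (even_powers n)) x y = 2 * real n * x ^ (2 * n - 1)"
    and "eval2 (pderiv_x (pderiv_x (even_powers n))) x y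
      = 2 * real n * (2 * real n - 1) * x ^ (2 * n - 2)"
    and "eval2 (pderiv_y (even_powers n)) x y = 2 * real n * y ^ (2 * n - 1)"
    and "eval2 (pderiv_y (pderiv_y (even_powers n))) x y
      = 2 * real n * (2 * real n - 1) * y ^ (2 * n - 2)"
proof -
  define k where "k = 2 * n"
  have k: "k \<ge> 2" "real k = 2 * real n" using assms by (simp_all add: k_def)
  have Q: "even_powers n = X ^ k + Y ^ k" by (simp add: even_powers_def k_def)
  have kk: "k - 1 - 1 = k - 2" "real (k - 1) = real k - 1" using k(1) by (simp_all add: of_nat_diff)
  have D: "pderiv_x (even_powers n) = of_nat k * X ^ (k - 1)"
    "pderiv_y (even_powers n) = of_nat k * Y ^ (k - 1)"
    by (simp_all add: Q pderiv_x_power pderiv_y_power)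
  have "eval2 (pderiv_x (even_powers n)) x y = real k * x ^ (k - 1)"
    "eval2 (pderiv_y (even_powers n)) x y = real k * y ^ (k - 1)"
    by (simp_all add: D)
  moreover have "eval2 (pderiv_x (pderiv_x (even_powers n))) x y = real k * (real k - 1) * x ^ (k - 2)"
    "eval2 (pderiv_y (pderiv_y (even_powers n))) x y = real k * (real k - 1) * y ^ (k - 2)"
    using kk by (simp_all add: D pderiv_x_mult pderiv_y_mult pderiv_x_power pderiv_y_power)
  ultimately show "eval2 (pderiv_x (even_powers n)) x y = 2 * real n * x ^ (2 * n - 1)"
    "eval2 (pderiv_x (pderiv_x (even_powers n))) x y
      = 2 * real n * (2 * real n - 1) * x ^ (2 * n - 2)"
    "eval2 (pderiv_y (even_powers n)) x y = 2 * real n * y ^ (2 * n - 1)"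
    "eval2 (pderiv_y (pderiv_y (even_powers n))) x y
      = 2 * real n * (2 * real n - 1) * y ^ (2 * n - 2)"
    unfolding k(2) by (simp_all only: k_def)
qed

text \<open>\<open>s a\<close> and \<open>w\<close> are the logarithmic derivatives \<open>x f\<^sub>x / f\<close> of the factors of \<open>f\<close>.\<close>

lemma hessian_neg_off_axes:
  assumes "finite A" "1 \<in> A" "-1 \<in> A" "n \<ge> 1" "x \<noteq> 0" "y \<noteq> 0"
    and nz: "eval2 (line_product n A) x y \<noteq> 0"
  shows "eval2 (hessian (line_product n A)) x y < 0"
proof -
  define f P where "f = eval2 (line_product n A) x y" and "P = eval2 (\<Prod>a\<in>A. line a) x y"
  define q where "q = x ^ (2 * n) + y ^ (2 * n)"
  have q: "q > 0" using even_powers_pos[of x y n] assms by (simp add: q_def)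
  have f: "f = q * P" by (simp add: f_def P_def q_def line_product_def)
  define N where "N = 2 * real n"
  define w where "w = x ^ (2 * n) / q"
  define t s where "t = (\<lambda>a. 1 / (x - a * y))" and "s = (\<lambda>a. x / (x - a * y))"
  have lines: "x - a * y \<noteq> 0" if "a \<in> A" for a
    using nz that assms(1) by (auto simp: line_product_def eval2_prod)
  have st: "(\<Sum>a\<in>A. s a) = x * (\<Sum>a\<in>A. t a)" "(\<Sum>a\<in>A. (s a)\<^sup>2) = x\<^sup>2 * (\<Sum>a\<in>A. (t a)\<^sup>2)"
    by (simp_all add: s_def t_def sum_distrib_left power_divide)
  define S1 S2 where "S1 = (\<Sum>a\<in>A. s a)" and "S2 = (\<Sum>a\<in>A. (s a)\<^sup>2)"
  define U where "U = S1 + N * w"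
  have P': "eval2 (pderiv_x (\<Prod>a\<in>A. line a)) x y = P * (\<Sum>a\<in>A. t a)"
    "eval2 (pderiv_x (pderiv_x (\<Prod>a\<in>A. line a))) x y
      = P * ((\<Sum>a\<in>A. t a)\<^sup>2 - (\<Sum>a\<in>A. (t a)\<^sup>2))"
    using log_derivative_prod[of pderiv_x A line x y] assms(1) lines
    by (simp_all add: pderiv_x_mult P_def t_def)
  have P1: "x * eval2 (pderiv_x (\<Prod>a\<in>A. line a)) x y = P * S1"
    and P2: "x\<^sup>2 * eval2 (pderiv_x (pderiv_x (\<Prod>a\<in>A. line a))) x y = P * (S1\<^sup>2 - S2)"
    unfolding P' S1_def S2_def st by (simp_all add: power2_eq_square algebra_simps)
  define Q where "Q = even_powers n"
  have Q0: "eval2 Q x y = q" by (simp add: Q_def q_def)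
  have xs: "x * x ^ (2 * n - 1) = x ^ (2 * n)" "x\<^sup>2 * x ^ (2 * n - 2) = x ^ (2 * n)"
    using assms(4) by (cases n; simp add: power2_eq_square)+
  have Q1: "x * eval2 (pderiv_x Q) x y = q * (N * w)"
    and Q2: "x\<^sup>2 * eval2 (pderiv_x (pderiv_x Q)) x y = q * (N * (N - 1) * w)"
    using xs q by (simp_all add: eval2_derivs_even_powers[OF assms(4)] Q_def N_def w_def
        mult.left_commute[of x] mult.left_commute[of "x\<^sup>2"])
  have F: "line_product n A = Q * (\<Prod>a\<in>A. line a)" by (simp add: line_product_def Q_def)
  have F1: "x * eval2 (pderiv_x (line_product n A)) x y = f * U"
  proof -
    have "x * eval2 (pderiv_x (line_product n A)) x y
      = x * eval2 (pderiv_x Q) x y * P + q * (x * eval2 (pderiv_x (\<Prod>a\<in>A. line a)) x y)"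
      by (simp add: F pderiv_x_mult Q0 P_def algebra_simps)
    then show ?thesis unfolding Q1 P1 by (simp add: f U_def algebra_simps)
  qed
  \<comment> \<open>The subtracted term is minus the derivative of the logarithmic derivative of
    \<open>f\<close>, times \<open>x\<^sup>2\<close>.\<close>
  have F2: "x\<^sup>2 * eval2 (pderiv_x (pderiv_x (line_product n A))) x y
      = f * (U\<^sup>2 - (S2 - N * (N - 1) * w + N\<^sup>2 * w\<^sup>2))"
  proof -
    have "x\<^sup>2 * eval2 (pderiv_x (pderiv_x (line_product n A))) x y
      = x\<^sup>2 * eval2 (pderiv_x (pderiv_x Q)) x y * P
        + 2 * (x * eval2 (pderiv_x Q) x y) * (x * eval2 (pderiv_x (\<Prod>a\<in>A. line a)) x y)
        + q * (x\<^sup>2 * eval2 (pderiv_x (pderiv_x (\<Prod>a\<in>A. line a))) x y)"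
      by (simp add: F pderiv_x_mult Q0 P_def power2_eq_square algebra_simps)
    then show ?thesis unfolding Q1 Q2 P1 P2
      by (simp add: f U_def power2_eq_square algebra_simps)
  qed
  define d where "d = 2 * n + card A"
  have hom: "homogeneous d (line_product n A)"
    unfolding d_def by (rule homogeneous_line_product)
  have d: "real d = N + real (card A)" by (simp add: d_def N_def)
  have "U\<^sup>2 < d * (S2 - N * (N - 1) * w + N\<^sup>2 * w\<^sup>2)"
    unfolding U_def d S1_def S2_def N_def w_def q_def
    using assms lines[of 1] lines[of "-1"] by (intro log_derivative_inequality) (auto simp: s_def)
  then have neg: "d * (U\<^sup>2 - (S2 - N * (N - 1) * w + N\<^sup>2 * w\<^sup>2)) - (real d - 1) * U\<^sup>2 < 0"
    by (simp add: algebra_simps)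
  define H where "H = eval2 (hessian (line_product n A)) x y"
  \<comment> \<open>The extra factor \<open>x\<^sup>2\<close> turns the derivatives into the
    scale-invariant \<open>x f\<^sub>x\<close> and
    \<open>x\<^sup>2 f\<^sub>x\<^sub>x\<close>.\<close>
  have "x\<^sup>2 * (y\<^sup>2 * H) = (real d - 1) * (d * f * (x\<^sup>2 * eval2 (pderiv_x (pderiv_x (line_product n A))) x y)
    - (real d - 1) * (x * eval2 (pderiv_x (line_product n A)) x y)\<^sup>2)"
    unfolding H_def hessian_via_x[OF hom] by (simp add: f_def power_mult_distrib algebra_simps)
  also have "\<dots> = ((real d - 1) * f\<^sup>2) *
      (d * (U\<^sup>2 - (S2 - N * (N - 1) * w + N\<^sup>2 * w\<^sup>2)) - (real d - 1) * U\<^sup>2)"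
    unfolding F1 F2 by (simp add: power2_eq_square algebra_simps)
  also have "\<dots> < 0"
  proof (rule mult_pos_neg)
    have "real d > 1" using assms(4) by (simp add: d_def)
    then show "(real d - 1) * f\<^sup>2 > 0" using nz by (simp add: f_def)
  qed (fact neg)
  finally have "(x\<^sup>2 * y\<^sup>2) * H < 0" by (simp add: mult.assoc)
  then show ?thesis by (simp add: H_def mult_less_0_iff)
qed

text \<open>At \<open>y = 0\<close> the line \<open>a\<close> has logarithmic y-derivative
  \<open>- a / x\<close>, and the even factor enters only through its second derivative. The exact
  value shows the degeneracy for \<open>n = 1\<close> and parameters -1, 0, 1.\<close>

lemma hessian_on_x_axis:
  assumes "finite A" "n \<ge> 1" "x \<noteq> 0"
  defines "d \<equiv> 2 * real n + card A"
  shows "x ^ 4 * eval2 (hessian (line_product n A)) x 0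
    = (d - 1) * (eval2 (line_product n A) x 0)\<^sup>2 *
      ((\<Sum>a\<in>A. a)\<^sup>2 - d * ((\<Sum>a\<in>A. a\<^sup>2) - (if n = 1 then 2 else 0)))"
proof -
  define e :: real where "e = (if n = 1 then 2 else 0)"
  define f where "f = eval2 (line_product n A) x 0"
  define Q where "Q = even_powers n"
  define P where "P = eval2 (\<Prod>a\<in>A. line a) x 0"
  define S1 S2 where "S1 = (\<Sum>a\<in>A. a)" and "S2 = (\<Sum>a\<in>A. a\<^sup>2)"
  have F: "line_product n A = Q * (\<Prod>a\<in>A. line a)" by (simp add: line_product_def Q_def)
  have t: "(\<Sum>a\<in>A. - a / x) = - (S1 / x)" "(\<Sum>a\<in>A. (- a / x)\<^sup>2) = S2 / x\<^sup>2"
    by (simp_all add: S1_def S2_def sum_divide_distrib sum_negf power_divide)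
  have yl: "pderiv_y (- [:[:a:]:]) = 0" for a
    using pderiv_y_diff[of 0 "[:[:a:]:]"] by simp
  have "eval2 (pderiv_y (\<Prod>a\<in>A. line a)) x 0 = P * (\<Sum>a\<in>A. - a / x)"
    "eval2 (pderiv_y (pderiv_y (\<Prod>a\<in>A. line a))) x 0
      = P * ((\<Sum>a\<in>A. - a / x)\<^sup>2 - (\<Sum>a\<in>A. (- a / x)\<^sup>2))"
    using log_derivative_prod[of pderiv_y A line x 0] assms(1,3)
    by (simp_all add: pderiv_y_mult P_def yl)
  then have P1: "x * eval2 (pderiv_y (\<Prod>a\<in>A. line a)) x 0 = - P * S1"
    and P2: "x\<^sup>2 * eval2 (pderiv_y (pderiv_y (\<Prod>a\<in>A. line a))) x 0 = P * (S1\<^sup>2 - S2)"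
    unfolding t using assms(3) by (simp_all add: field_simps)
  have Q0: "eval2 Q x 0 = x ^ (2 * n)" using assms(2) by (simp add: Q_def)
  have Q1: "eval2 (pderiv_y Q) x 0 = 0"
    using assms(2) by (simp add: Q_def eval2_derivs_even_powers)
  have Q2: "x\<^sup>2 * eval2 (pderiv_y (pderiv_y Q)) x 0 = x ^ (2 * n) * e"
    using assms(2) by (simp add: Q_def eval2_derivs_even_powers e_def)
  have f: "f = x ^ (2 * n) * P" by (simp add: f_def F Q0 P_def)
  have F1: "x * eval2 (pderiv_y (line_product n A)) x 0 = - f * S1"
    using P1 by (simp add: F pderiv_y_mult Q0 Q1 f mult.left_commute[of x])
  have F2: "x\<^sup>2 * eval2 (pderiv_y (pderiv_y (line_product n A))) x 0 = f * (S1\<^sup>2 - S2 + e)"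
  proof -
    have "x\<^sup>2 * eval2 (pderiv_y (pderiv_y (line_product n A))) x 0
      = x\<^sup>2 * eval2 (pderiv_y (pderiv_y Q)) x 0 * P
        + x ^ (2 * n) * (x\<^sup>2 * eval2 (pderiv_y (pderiv_y (\<Prod>a\<in>A. line a))) x 0)"
      by (simp add: F pderiv_y_mult Q0 Q1 P_def algebra_simps)
    then show ?thesis unfolding Q2 P2 by (simp add: f algebra_simps)
  qed
  define H where "H = eval2 (hessian (line_product n A)) x 0"
  have d: "real (2 * n + card A) = d" by (simp add: d_def)
  have "x\<^sup>2 * (x\<^sup>2 * H) = (d - 1) * (d * f * (x\<^sup>2 * eval2 (pderiv_y (pderiv_y (line_product n A))) x 0)
    - (d - 1) * (x * eval2 (pderiv_y (line_product n A)) x 0)\<^sup>2)"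
    unfolding H_def hessian_via_y[OF homogeneous_line_product] d
    by (simp add: f_def power_mult_distrib algebra_simps)
  also have "\<dots> = (d - 1) * f\<^sup>2 * (S1\<^sup>2 - d * (S2 - e))"
    unfolding F1 F2 by (simp add: power2_eq_square algebra_simps)
  finally show ?thesis
    by (simp add: H_def f_def S1_def S2_def e_def power2_eq_square power4_eq_xxxx mult.assoc)
qed

text \<open>On \<open>x = 0\<close> only the factor \<open>x\<^sup>2 - y\<^sup>2\<close> contributes
  to the second x-derivative. For \<open>n = 1\<close> the form is \<open>x ^ 4 - y ^ 4\<close>,
  whose Hessian vanishes there.\<close>

lemma hessian_neg_on_y_axis:
  assumes "n \<ge> 2" "y \<noteq> 0"
  shows "eval2 (hessian (line_product n {1, -1})) 0 y < 0"
proof -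
  define f where "f = line_product n {1, -1}"
  have f: "f = even_powers n * (line 1 * line (-1))" by (simp add: f_def line_product_def)
  have n: "n \<ge> 1" using assms(1) by simp
  have Q: "eval2 (pderiv_x (even_powers n)) 0 y = 0"
    "eval2 (pderiv_x (pderiv_x (even_powers n))) 0 y = 0"
    using assms(1) by (simp_all add: eval2_derivs_even_powers[OF n])
  have E: "eval2 f 0 y = - (y ^ (2 * n)) * y\<^sup>2" "eval2 (pderiv_x f) 0 y = 0"
    "eval2 (pderiv_x (pderiv_x f)) 0 y = 2 * y ^ (2 * n)"
    using Q n by (simp_all add: f pderiv_x_mult power2_eq_square)
  have hom: "homogeneous (2 * n + 2) f"
    using homogeneous_line_product[of n "{1, -1}"] by (simp add: f_def)
  have "y\<^sup>2 * eval2 (hessian f) 0 y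
      = (real (2 * n + 2) - 1) * (- (real (2 * n + 2) * (2 * (y ^ (2 * n))\<^sup>2 * y\<^sup>2)))"
    unfolding hessian_via_x[OF hom] by (simp add: E power2_eq_square)
  also have "\<dots> < 0"
    using assms(2) by (intro mult_pos_neg) auto
  finally show ?thesis by (simp add: f_def mult_less_0_iff)
qed

subsection \<open>The three families\<close>

text \<open>Only the x-axis needs a condition on the parameters. The weak inequality gives a
  nonpositive Hessian, enough for the index; thus the index is available for
  \<open>f_odd 1 1\<close>, which is not hyperbolic.\<close>

lemma line_product_hyperbolic_index:
  assumes A: "finite A" "1 \<in> A" "-1 \<in> A" and n: "n \<ge> 1"
    and x0: "n \<ge> 2 \<and> A = {1, -1} \<or> 0 \<in> A"
    and le: "(\<Sum>a\<in>A. a)\<^sup>2 \<le> (2 * real n + card A) * ((\<Sum>a\<in>A. a\<^sup>2) - (if n = 1 then 2 else 0))"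
  shows "Ind (gamma (line_product n A)) = 2 - of_nat (card A)"
    and "(\<Sum>a\<in>A. a)\<^sup>2 < (2 * real n + card A) * ((\<Sum>a\<in>A. a\<^sup>2) - (if n = 1 then 2 else 0))
      \<Longrightarrow> hyperbolic (line_product n A)"
proof -
  define d where "d = 2 * n + card A"
  have "d \<ge> 2" using n by (simp add: d_def)
  have hom: "homogeneous d (line_product n A)"
    unfolding d_def by (rule homogeneous_line_product)
  have simp: "simple_zeros (line_product n A)"
    using A n by (intro simple_zeros_line_product)
  define E where "E = (\<Sum>a\<in>A. a)\<^sup>2 - (2 * real n + card A) * ((\<Sum>a\<in>A. a\<^sup>2) - (if n = 1 then 2 else 0))"
  have y_neq_0: "eval2 (hessian (line_product n A)) x y < 0" if "y \<noteq> 0" for x y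
  proof (cases "eval2 (line_product n A) x y = 0")
    case True
    then show ?thesis
      using hessian_neg_at_zero[OF hom \<open>d \<ge> 2\<close> simp] that by simp
  next
    case nz: False
    show ?thesis
    proof (cases "x = 0")
      case False
      then show ?thesis using hessian_neg_off_axes A n nz that by blast
    next
      case True
      \<comment> \<open>If 0 were a parameter, the y-axis would be a zero line, contrary to
        \<open>nz\<close>.\<close>
      have "0 \<notin> A" using nz A(1) True by (auto simp: line_product_def eval2_prod)
      then have n2: "n \<ge> 2" and A2: "A = {1, -1}" using x0 by auto
      show ?thesis
        unfolding True A2 using n2 that by (intro hessian_neg_on_y_axis)
    qed
  qed
  have y_eq_0: "x ^ 4 * eval2 (hessian (line_product n A)) x 0
      = (real d - 1) * (eval2 (line_product n A) x 0)\<^sup>2 * E" if "x \<noteq> 0" for x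
    using hessian_on_x_axis[OF A(1) n that] by (simp add: E_def d_def)
  have nz: "eval2 (line_product n A) x 0 \<noteq> 0" if "x \<noteq> 0" for x
    using that n A(1) by (simp add: line_product_def eval2_prod zero_power)
  have sgn: "x ^ 4 > 0" "(real d - 1) * (eval2 (line_product n A) x 0)\<^sup>2 > 0" if "x \<noteq> 0" for x :: real
    using that nz[OF that] \<open>d \<ge> 2\<close> by simp_all
  show "Ind (gamma (line_product n A)) = 2 - of_nat (card A)"
  proof -
    have "eval2 (hessian (line_product n A)) x y \<le> 0" if "(x, y) \<noteq> (0, 0)" for x y
    proof (cases "y = 0")
      case True
      then have "x \<noteq> 0" using that by simp
      have "E \<le> 0" using le by (simp add: E_def)
      then have "(real d - 1) * (eval2 (line_product n A) x 0)\<^sup>2 * E \<le> 0"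
        using sgn(2)[OF \<open>x \<noteq> 0\<close>] by (intro mult_nonneg_nonpos) auto
      then have "x ^ 4 * eval2 (hessian (line_product n A)) x 0 \<le> 0"
        unfolding y_eq_0[OF \<open>x \<noteq> 0\<close>] .
      then show ?thesis
        unfolding True using sgn(1)[OF \<open>x \<noteq> 0\<close>] by (meson mult_pos_pos not_le)
    qed (use y_neq_0 in \<open>simp add: less_imp_le\<close>)
    then show ?thesis
      using Ind_gamma_eq[OF hom \<open>d \<ge> 2\<close> _ simp] jet_index_line_product[OF A(1) n] by simp
  qed
  assume less: "(\<Sum>a\<in>A. a)\<^sup>2 < (2 * real n + card A) * ((\<Sum>a\<in>A. a\<^sup>2) - (if n = 1 then 2 else 0))"
  have "eval2 (hessian (line_product n A)) x y < 0" if "(x, y) \<noteq> (0, 0)" for x y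
  proof (cases "y = 0")
    case True
    then have "x \<noteq> 0" using that by simp
    have "E < 0" using less by (simp add: E_def)
    then have "(real d - 1) * (eval2 (line_product n A) x 0)\<^sup>2 * E < 0"
      using sgn(2)[OF \<open>x \<noteq> 0\<close>] by (intro mult_pos_neg)
    then have "x ^ 4 * eval2 (hessian (line_product n A)) x 0 < 0"
      unfolding y_eq_0[OF \<open>x \<noteq> 0\<close>] .
    then show ?thesis
      unfolding True using sgn(1)[OF \<open>x \<noteq> 0\<close>] by (simp add: mult_less_0_iff)
  qed (use y_neq_0 in simp)
  then show "hyperbolic (line_product n A)"
    using hom \<open>d \<ge> 2\<close> by (auto simp: hyperbolic_def)
qed

section \<open>The line parameters of the odd family\<close>

text \<open>The parameter 0 comes from the factor \<open>X\<close>, and the pair of \<open>i\<close>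
  and \<open>- i\<close> from \<open>x\<^sup>2 - i\<^sup>2 y\<^sup>2\<close>.\<close>

definition slopes :: "nat \<Rightarrow> real set" where
  "slopes k = real_of_int ` {- int k..int k}"

lemma slopes_Suc: "slopes (Suc k) = insert (real (Suc k)) (insert (- real (Suc k)) (slopes k))"
proof -
  have "{- int (Suc k)..int (Suc k)} = insert (int (Suc k)) (insert (- int (Suc k)) {- int k..int k})"
    by auto
  then show ?thesis by (simp add: slopes_def)
qed

lemma slopes_bound: "a \<in> slopes k \<Longrightarrow> \<bar>a\<bar> \<le> real k"
  by (auto simp: slopes_def)

lemma finite_slopes: "finite (slopes k)"
  by (simp add: slopes_def)

lemma Suc_notin_slopes:
  "real (Suc k) \<notin> slopes k" "- real (Suc k) \<notin> slopes k" "real (Suc k) \<noteq> - real (Suc k)"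
  using slopes_bound[of "real (Suc k)" k] slopes_bound[of "- real (Suc k)" k] by auto

lemma card_slopes: "card (slopes k) = 2 * k + 1"
  by (simp add: slopes_def card_image inj_on_def)

lemma of_int_in_slopes: "\<bar>i\<bar> \<le> int k \<Longrightarrow> real_of_int i \<in> slopes k"
  unfolding slopes_def by (intro imageI) auto

lemma sum_slopes: "(\<Sum>a\<in>slopes k. a) = 0"
proof (induction k)
  case (Suc k)
  then show ?case using Suc_notin_slopes[of k] by (simp add: slopes_Suc finite_slopes)
qed (simp add: slopes_def)

text \<open>The bound 2 is the correction for \<open>n = 1\<close> on the x-axis; equality at
  \<open>k = 1\<close> is the excluded case.\<close>

lemma sum_squares_slopes:
  assumes "k \<ge> 1"
  shows "(\<Sum>a\<in>slopes k. a\<^sup>2) \<ge> 2" "k \<noteq> 1 \<Longrightarrow> (\<Sum>a\<in>slopes k. a\<^sup>2) > 2"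
proof -
  have rec: "(\<Sum>a\<in>slopes (Suc k). a\<^sup>2) = (\<Sum>a\<in>slopes k. a\<^sup>2) + 2 * (real (Suc k))\<^sup>2" for k
    using Suc_notin_slopes[of k] by (simp add: slopes_Suc finite_slopes del: of_nat_Suc)
  have ge: "(\<Sum>a\<in>slopes (Suc k). a\<^sup>2) \<ge> 2" for k
  proof -
    have "(\<Sum>a\<in>slopes k. a\<^sup>2) \<ge> 0" by (intro sum_nonneg) simp
    moreover have "(real (Suc k))\<^sup>2 \<ge> 1" by (simp del: of_nat_Suc)
    ultimately show ?thesis by (simp only: rec)
  qed
  obtain j where j: "k = Suc j" using assms by (cases k) auto
  show "(\<Sum>a\<in>slopes k. a\<^sup>2) \<ge> 2" using ge j by simp
  show "(\<Sum>a\<in>slopes k. a\<^sup>2) > 2" if k1: "k \<noteq> 1"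
  proof -
    obtain i where "j = Suc i" using j k1 by (cases j) auto
    moreover have "(real (Suc j))\<^sup>2 > 0" by (simp del: of_nat_Suc)
    ultimately show ?thesis using ge[of i] by (simp only: rec j)
  qed
qed

lemma line_of_nat: "line (real i) = X - of_nat i * Y" "line (- real i) = X + of_nat i * Y"
  by (simp_all add: line_def Y_def of_nat_poly)

lemma prod_line_slopes: "(\<Prod>a\<in>slopes k. line a) = X * (\<Prod>i=1..k. X\<^sup>2 - of_nat i ^ 2 * Y\<^sup>2)"
proof (induction k)
  case 0
  then show ?case using line_of_nat(1)[of 0] by (simp add: slopes_def)
next
  case (Suc k)
  have "line (real (Suc k)) * line (- real (Suc k)) = X\<^sup>2 - of_nat (Suc k) ^ 2 * Y\<^sup>2"
    unfolding line_of_nat by (simp add: power2_eq_square algebra_simps)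
  moreover have "(\<Prod>a\<in>slopes (Suc k). line a)
      = (line (real (Suc k)) * line (- real (Suc k))) * (\<Prod>a\<in>slopes k. line a)"
    using Suc_notin_slopes[of k] by (simp only: slopes_Suc) (simp add: finite_slopes mult.assoc del: of_nat_Suc)
  ultimately show ?case
    using Suc by (simp add: mult_ac del: of_nat_Suc)
qed

lemma g_poly_eq: "g_poly n = line_product n {1, -1}"
proof -
  have "line 1 = X - Y" "line (-1) = X + Y" using line_of_nat[of 1] by simp_all
  moreover have "(\<Prod>a\<in>{1, -1}. line a) = line 1 * line (-1)" by simp
  ultimately have "(\<Prod>a\<in>{1, -1}. line a) = X\<^sup>2 - Y\<^sup>2"
    by (simp only:) (simp add: power2_eq_square algebra_simps)
  then show ?thesis by (simp only: g_poly_def line_product_def even_powers_def mult.commute)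
qed

lemma f_odd_eq: "f_odd n k = line_product n (slopes k)"
  by (simp add: f_odd_def line_product_def even_powers_def prod_line_slopes mult_ac)

lemma f_even_eq: "f_even n k = line_product n (insert (real (k + 1)) (slopes k))"
  using Suc_notin_slopes(1)[of k] line_of_nat(1)[of "k + 1"]
  by (simp add: f_even_def line_product_def even_powers_def prod_line_slopes finite_slopes mult_ac)

theorem theorem2p3:
  fixes n :: nat
  assumes "n \<ge> 1"
  shows
    "(n \<ge> 2 \<longrightarrow>
        homogeneous (2 * n + 2) (g_poly n) \<and> hyperbolic (g_poly n) \<and>
        Ind (gamma (g_poly n)) = 0) \<and>
     (\<forall>k\<ge>1.
        homogeneous (2 * n + 2 * k + 1) (f_odd n k) \<and>
        ((n, k) \<noteq> (1, 1) \<longrightarrow> hyperbolic (f_odd n k)) \<and>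
        Ind (gamma (f_odd n k)) = of_int (2 - 2 * int k - 1)) \<and>
     (\<forall>k\<ge>1.
        homogeneous (2 * n + 2 * k + 2) (f_even n k) \<and>
        hyperbolic (f_even n k) \<and>
        Ind (gamma (f_even n k)) = of_int (2 - 2 * int k - 2))"
proof (intro conjI allI impI)
  assume "n \<ge> 2"
  show "homogeneous (2 * n + 2) (g_poly n)"
    using homogeneous_line_product[of n "{1, -1}"] by (simp add: g_poly_eq)
  show "hyperbolic (g_poly n)" "Ind (gamma (g_poly n)) = 0"
    using line_product_hyperbolic_index[of "{1, -1}" n] \<open>n \<ge> 2\<close> by (simp_all add: g_poly_eq)
next
  fix k :: nat assume k: "k \<ge> 1"
  have A: "finite (slopes k)" "1 \<in> slopes k" "-1 \<in> slopes k" "0 \<in> slopes k"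
    using finite_slopes of_int_in_slopes[of 1 k] of_int_in_slopes[of "-1" k] of_int_in_slopes[of 0 k] k
    by simp_all
  define S where "S = (\<Sum>a\<in>slopes k. a\<^sup>2)"
  define e :: real where "e = (if n = 1 then 2 else 0)"
  have S: "S - e \<ge> 0" "(n, k) \<noteq> (1, 1) \<Longrightarrow> S - e > 0"
    using sum_squares_slopes[OF k] by (auto simp: S_def e_def)
  \<comment> \<open>The parameters cancel in pairs, so the condition on the x-axis reduces to the
    sign of \<open>S - e\<close>.\<close>
  have le: "(\<Sum>a\<in>slopes k. a)\<^sup>2 \<le> (2 * real n + card (slopes k)) * (S - e)"
    using S(1) by (simp add: sum_slopes)
  show "homogeneous (2 * n + 2 * k + 1) (f_odd n k)"
    using homogeneous_line_product[of n "slopes k"] by (simp add: f_odd_eq card_slopes)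
  show "Ind (gamma (f_odd n k)) = of_int (2 - 2 * int k - 1)"
    using line_product_hyperbolic_index(1)[of "slopes k" n] A assms le
    by (simp add: f_odd_eq card_slopes S_def e_def)
  show "hyperbolic (f_odd n k)" if "(n, k) \<noteq> (1, 1)"
  proof -
    have "(\<Sum>a\<in>slopes k. a)\<^sup>2 < (2 * real n + card (slopes k)) * (S - e)"
      using S(2)[OF that] assms by (simp add: sum_slopes add_pos_nonneg)
    then show ?thesis
      using line_product_hyperbolic_index(2)[of "slopes k" n] A assms le
      by (simp add: f_odd_eq S_def e_def)
  qed
  define B where "B = insert (real (k + 1)) (slopes k)"
  have notin: "real (k + 1) \<notin> slopes k" using Suc_notin_slopes(1)[of k] by simp
  then have card_B: "card B = 2 * k + 2"
    using finite_slopes by (simp add: B_def card_slopes)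
  have sums: "(\<Sum>a\<in>B. a) = real (k + 1)" "(\<Sum>a\<in>B. a\<^sup>2) = (real (k + 1))\<^sup>2 + S"
    unfolding B_def using notin finite_slopes by (simp_all add: sum_slopes S_def)
  have less: "(\<Sum>a\<in>B. a)\<^sup>2 < (2 * real n + card B) * ((\<Sum>a\<in>B. a\<^sup>2) - e)"
  proof -
    have pos: "(real (k + 1))\<^sup>2 > 0" by simp
    \<comment> \<open>The unpaired parameter \<open>k + 1\<close> adds its square to both sides, on
      the right with a factor of at least 2; so strictness holds even for
      \<open>n = k = 1\<close>.\<close>
    have "(real (k + 1))\<^sup>2 < 2 * (real (k + 1))\<^sup>2" using pos by simp
    also have "\<dots> \<le> (2 * real n + card B) * ((real (k + 1))\<^sup>2 + S - e)"
      using assms S(1) pos by (intro mult_mono) auto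
    finally show ?thesis by (simp add: sums)
  qed
  have f_even: "f_even n k = line_product n B" unfolding B_def by (rule f_even_eq)
  have B: "finite B" "1 \<in> B" "-1 \<in> B" "0 \<in> B" using A by (simp_all add: B_def)
  show "homogeneous (2 * n + 2 * k + 2) (f_even n k)"
    using homogeneous_line_product[of n B] by (simp add: f_even card_B)
  show "hyperbolic (f_even n k)" "Ind (gamma (f_even n k)) = of_int (2 - 2 * int k - 2)"
    using line_product_hyperbolic_index[of B n] B assms less
    by (simp_all add: f_even card_B e_def)
qed

end
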